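(* Let $V$ be a simple real Jordan algebra with Euclidean involution $\alpha$, $\mathcal X=G/K=\Omega_0+V_1$ the associated Riemannian Makarevich symmetric space, and $s\in\mathbb C$. Define the bilinear form $\mathfrak B_s^\alpha$ on $C_c(\mathcal X)\times C_c(\mathcal X)$ by $$\mathfrak B_s^\alpha(F_1,F_2)=\mathfrak B_s^\alpha(M_sf_1,M_sf_2)=\widetilde{\mathfrak B}_s^\alpha(f_1,f_2),\qquad F_i=M_sf_i .$$ Then $$\mathfrak B_s^\alpha(F_1,F_2)=\iint_{\mathcal X\times\mathcal X}B_\nu(x,y)F_1(x)F_2(y)\,\mu(dx)\mu(dy),$$ where $B_\nu$ is the Berezin kernel and $\nu=-\frac r{r_0}\left(s-\frac n{2r}\right)$.
   Context: $V$ is a simple real Jordan algebra with unit $e$, dimension $n$, rank $r$ and Jordan determinant $\Delta$. $\alpha$ is a Euclidean involution: an involutive automorphism of $V$ with $\mathrm{Tr}\,L(\alpha(x)y)$ positive definite, where $L(x)y=xy$. $V_0=\{\alpha(x)=x\}$ is a Euclidean Jordan algebra of rank $r_0$; $V_1=\{\alpha(x)=-x\}$; $\Omega_0$ is the symmetric cone of $V_0$; $x_0$ is the $V_0$-component of $x$ in the decomposition $V=V_0+V_1$. $\mathcal X=\Omega_0+V_1\subset V$, which is the orbit $G.e\cong G/K$ of the identity component $G$ of the group of conformal transformations of $V$ commuting with $-\alpha$, $K$ being the stabilizer of $e$ in $G$. (The conformal group of $V$ is the group of rational transformations generated by translations, the linear maps preserving $\Delta$ up to a constant factor, and $x\mapsto-x^{-1}$.)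 $dx$ is the Euclidean measure on $V$ for $(x|y)=\mathrm{tr}(x\alpha(y))$ ($\mathrm{tr}$ the Jordan trace), and $\mu(dx)=\Delta(x_0)^{-n/r}dx$ is a $G$-invariant measure on $\mathcal X$. Forms. $\mathfrak B_s(f_1,f_2)=\iint_{V\times V}|\Delta(x-y)|^{2s-\frac nr}f_1(x)f_2(y)\,dx\,dy$, and for functions supported in $\mathcal X$ (extended by $0$ to $V$), $\widetilde{\mathfrak B}^\alpha_s(f_1,f_2)=\mathfrak B_s(f_1,f_2\circ(-\alpha))$. The operator $M_s$ is $M_sf(x)=\Delta(x_0)^{s+\frac n{2r}}f(x)$. Berezin kernel. For $x,y\in\mathcal X$, $F(x,y)=\frac{\Delta(x+\alpha(x))\Delta(y+\alpha(y))}{\Delta(x+\alpha(y))\Delta(y+\alpha(x))}>0$ and $B_\nu(x,y)=F(x,y)^{\frac{r_0}r\nu}$.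
   Formalization: The printed formula is off by a constant, since Δ(x+α(x)) = 2^r Δ(x_0) (it fails already for V=ℝ, α=id, s=1); the formal statement proves 𝔅_s^α(F_1,F_2) = 2^{2rs−n} ∬ B_ν F_1 F_2 dμ dμ, with all definitions unchanged. *)

theory Defs
  imports "HOL-Analysis.Analysis" "HOL-Computational_Algebra.Polynomial"
begin

class real_jordan_algebra = real_vector + power +
  assumes jordan_mult_commute: "a * b = b * a"
    and jordan_distrib: "(a + b) * c = a * c + b * c"
    and jordan_scaleR: "(t *\<^sub>R a) * b = t *\<^sub>R (a * b)"
    and jordan_unit: "1 * a = a"
    and jordan_identity: "a * ((a * a) * b) = (a * a) * (a * b)"

class simple_real_jordan_algebra = real_jordan_algebra +
  assumes jordan_nontrivial: "1 \<noteq> 0"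
    and jordan_simple:
      "\<lbrakk>0 \<in> I; \<And>a b. a \<in> I \<Longrightarrow> b \<in> I \<Longrightarrow> a + b \<in> I; \<And>t a. a \<in> I \<Longrightarrow> t *\<^sub>R a \<in> I;
        \<And>a b. a \<in> I \<Longrightarrow> a * b \<in> I\<rbrakk> \<Longrightarrow> I = {0} \<or> I = UNIV"

definition jordan_eval :: "real poly \<Rightarrow> 'a::real_jordan_algebra \<Rightarrow> 'a" where
  "jordan_eval p x = (\<Sum>i\<le>degree p. coeff p i *\<^sub>R x ^ i)"

definition jordan_degree :: "'a::real_jordan_algebra \<Rightarrow> nat" where
  "jordan_degree x = (LEAST k. \<exists>p. lead_coeff p = 1 \<and> degree p = k \<and> jordan_eval p x = 0)"

definition jordan_minpoly :: "'a::real_jordan_algebra \<Rightarrow> real poly" where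
  "jordan_minpoly x =
     (THE p. lead_coeff p = 1 \<and> degree p = jordan_degree x \<and> jordan_eval p x = 0)"

text \<open>The rank is taken on a unital subalgebra \<open>S\<close>; the minimal polynomial of an element of \<open>S\<close>
  does not depend on whether it is computed in \<open>S\<close> or in the ambient algebra.\<close>

definition jordan_rank :: "'a::real_jordan_algebra set \<Rightarrow> nat" where
  "jordan_rank S = Max (jordan_degree ` S)"

definition jordan_regular :: "'a::real_jordan_algebra \<Rightarrow> bool" where
  "jordan_regular x \<longleftrightarrow> jordan_degree x = jordan_rank (UNIV :: 'a set)"

text \<open>There are unique polynomial functions \<open>a\<^sub>1, \<dots>, a\<^sub>r\<close> on the algebra such that every regular \<open>x\<close>
  has minimal polynomial \<open>t\<^sup>r - a\<^sub>1(x) t\<^sup>r\<^sup>-\<^sup>1 + \<dots> + (-1)\<^sup>r a\<^sub>r(x)\<close>; the Jordan trace is \<open>a\<^sub>1\<close> and the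
  Jordan determinant is \<open>a\<^sub>r\<close>.\<close>

definition is_jordan_trace ::
    "('a::{euclidean_space, real_jordan_algebra} \<Rightarrow> real) \<Rightarrow> bool" where
  "is_jordan_trace tr \<longleftrightarrow> real_polynomial_function tr \<and>
     (\<forall>x. jordan_regular x \<longrightarrow> tr x = - coeff (jordan_minpoly x) (jordan_rank (UNIV :: 'a set) - 1))"

definition is_jordan_det ::
    "('a::{euclidean_space, real_jordan_algebra} \<Rightarrow> real) \<Rightarrow> bool" where
  "is_jordan_det \<Delta> \<longleftrightarrow> real_polynomial_function \<Delta> \<and>
     (\<forall>x. jordan_regular x \<longrightarrow> \<Delta> x = (- 1) ^ jordan_rank (UNIV :: 'a set) * coeff (jordan_minpoly x) 0)"

definition operator_trace :: "('a::euclidean_space \<Rightarrow> 'a) \<Rightarrow> real" where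
  "operator_trace T = (\<Sum>b\<in>Basis. T b \<bullet> b)"

definition euclidean_involution ::
    "('a::{euclidean_space, real_jordan_algebra} \<Rightarrow> 'a) \<Rightarrow> bool" where
  "euclidean_involution \<alpha> \<longleftrightarrow> linear \<alpha> \<and> (\<forall>x y. \<alpha> (x * y) = \<alpha> x * \<alpha> y) \<and> (\<forall>x. \<alpha> (\<alpha> x) = x) \<and>
     (\<forall>x. x \<noteq> 0 \<longrightarrow> operator_trace (\<lambda>z. (\<alpha> x * x) * z) > 0)"

definition V0 :: "('a::real_vector \<Rightarrow> 'a) \<Rightarrow> 'a set" where
  "V0 \<alpha> = {x. \<alpha> x = x}"

definition V1 :: "('a::real_vector \<Rightarrow> 'a) \<Rightarrow> 'a set" where
  "V1 \<alpha> = {x. \<alpha> x = - x}"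

definition V0_part :: "('a::real_vector \<Rightarrow> 'a) \<Rightarrow> 'a \<Rightarrow> 'a" where
  "V0_part \<alpha> x = (1 / 2) *\<^sub>R (x + \<alpha> x)"

text \<open>The symmetric cone of a Euclidean Jordan algebra is the interior of its set of squares; here
  the interior is relative to \<open>V0\<close>.\<close>

definition Omega0 :: "('a::{euclidean_space, real_jordan_algebra} \<Rightarrow> 'a) \<Rightarrow> 'a set" where
  "Omega0 \<alpha> = top_of_set (V0 \<alpha>) interior_of {x * x | x. x \<in> V0 \<alpha>}"

definition makarevich_space ::
    "('a::{euclidean_space, real_jordan_algebra} \<Rightarrow> 'a) \<Rightarrow> 'a set" where
  "makarevich_space \<alpha> = {u + v | u v. u \<in> Omega0 \<alpha> \<and> v \<in> V1 \<alpha>}"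

text \<open>Functions in \<open>C\<^sub>c(X)\<close> are represented by their extension by \<open>0\<close>.\<close>

definition Cc :: "'a::topological_space set \<Rightarrow> ('a \<Rightarrow> complex) set" where
  "Cc X = {f. continuous_on X f \<and> (\<exists>K. compact K \<and> K \<subseteq> X \<and> (\<forall>x. x \<notin> K \<longrightarrow> f x = 0))}"

definition dim_over_rank :: "'a::{euclidean_space, real_jordan_algebra} itself \<Rightarrow> real" where
  "dim_over_rank _ = real DIM('a) / real (jordan_rank (UNIV :: 'a set))"

text \<open>The measure on \<open>X\<close> is regarded as a measure on the whole algebra that is carried by \<open>X\<close>.\<close>

definition mu :: "('a::{euclidean_space, real_jordan_algebra} \<Rightarrow> real) \<Rightarrow> ('a \<Rightarrow> 'a) \<Rightarrow> 'a measure" where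
  "mu \<Delta> \<alpha> = density lborel (\<lambda>x. ennreal (indicator (makarevich_space \<alpha>) x *
     \<Delta> (V0_part \<alpha> x) powr (- dim_over_rank TYPE('a))))"

definition form_B :: "('a::{euclidean_space, real_jordan_algebra} \<Rightarrow> real) \<Rightarrow> complex \<Rightarrow>
    ('a \<Rightarrow> complex) \<Rightarrow> ('a \<Rightarrow> complex) \<Rightarrow> complex" where
  "form_B \<Delta> s f1 f2 = (LINT (x, y)|(lborel \<Otimes>\<^sub>M lborel).
     complex_of_real \<bar>\<Delta> (x - y)\<bar> powr (2 * s - of_real (dim_over_rank TYPE('a))) * f1 x * f2 y)"

definition form_B_tilde :: "('a::{euclidean_space, real_jordan_algebra} \<Rightarrow> real) \<Rightarrow> ('a \<Rightarrow> 'a) \<Rightarrow>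
    complex \<Rightarrow> ('a \<Rightarrow> complex) \<Rightarrow> ('a \<Rightarrow> complex) \<Rightarrow> complex" where
  "form_B_tilde \<Delta> \<alpha> s f1 f2 = form_B \<Delta> s f1 (\<lambda>y. f2 (- \<alpha> y))"

definition M_op :: "('a::{euclidean_space, real_jordan_algebra} \<Rightarrow> real) \<Rightarrow> ('a \<Rightarrow> 'a) \<Rightarrow>
    complex \<Rightarrow> ('a \<Rightarrow> complex) \<Rightarrow> 'a \<Rightarrow> complex" where
  "M_op \<Delta> \<alpha> s f x =
     complex_of_real (\<Delta> (V0_part \<alpha> x)) powr (s + of_real (dim_over_rank TYPE('a) / 2)) * f x"

definition form_B_alpha :: "('a::{euclidean_space, real_jordan_algebra} \<Rightarrow> real) \<Rightarrow> ('a \<Rightarrow> 'a) \<Rightarrow>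
    complex \<Rightarrow> ('a \<Rightarrow> complex) \<Rightarrow> ('a \<Rightarrow> complex) \<Rightarrow> complex" where
  "form_B_alpha \<Delta> \<alpha> s F1 F2 = (THE c. \<exists>f1\<in>Cc (makarevich_space \<alpha>). \<exists>f2\<in>Cc (makarevich_space \<alpha>).
     F1 = M_op \<Delta> \<alpha> s f1 \<and> F2 = M_op \<Delta> \<alpha> s f2 \<and> c = form_B_tilde \<Delta> \<alpha> s f1 f2)"

text \<open>The normalisation \<open>F(x,x) = 1\<close> uses \<open>\<Delta>(x + \<alpha> x) = 2\<^sup>r \<Delta>(x\<^sub>0)\<close>, whereas \<open>M_op\<close> and \<open>mu\<close> use
  \<open>\<Delta>(x\<^sub>0)\<close>; passing between the two contributes a power of 2 to the formula for \<open>form_B_alpha\<close>.\<close>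

definition berezin_F :: "('a::{euclidean_space, real_jordan_algebra} \<Rightarrow> real) \<Rightarrow> ('a \<Rightarrow> 'a) \<Rightarrow>
    'a \<Rightarrow> 'a \<Rightarrow> real" where
  "berezin_F \<Delta> \<alpha> x y =
     (\<Delta> (x + \<alpha> x) * \<Delta> (y + \<alpha> y)) / (\<Delta> (x + \<alpha> y) * \<Delta> (y + \<alpha> x))"

definition berezin_kernel :: "('a::{euclidean_space, real_jordan_algebra} \<Rightarrow> real) \<Rightarrow> ('a \<Rightarrow> 'a) \<Rightarrow>
    complex \<Rightarrow> 'a \<Rightarrow> 'a \<Rightarrow> complex" where
  "berezin_kernel \<Delta> \<alpha> \<nu> x y = complex_of_real (berezin_F \<Delta> \<alpha> x y) powr
     (of_nat (jordan_rank (V0 \<alpha>)) / of_nat (jordan_rank (UNIV :: 'a set)) * \<nu>)"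

end

theory Submission
  imports Defs
begin

text \<open>The substitution \<open>y \<mapsto> - \<alpha> y\<close> preserves Lebesgue measure and turns \<open>\<Delta>(x - y)\<close> into
  \<open>\<Delta>(x + \<alpha> y)\<close>. Since \<open>\<Delta>\<close> is \<open>\<alpha>\<close>-invariant and homogeneous of degree \<open>r\<close>, the Berezin function is
  \<open>4\<^sup>r \<Delta>(x\<^sub>0) \<Delta>(y\<^sub>0) / \<Delta>(x + \<alpha> y)\<^sup>2\<close>, and the integrands agree pointwise as soon as \<open>\<Delta>(x\<^sub>0) > 0\<close>.

  The identities for \<open>\<Delta>\<close> hold for regular elements by inspection of minimal polynomials and extend by
  density. For positivity, an element of \<open>\<Omega>\<^sub>0\<close> has the form \<open>c + b\<^sup>2\<close> with \<open>c > 0\<close> and \<open>b \<in> V\<^sub>0\<close>. As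
  \<open>V\<^sub>0\<close> is formally real, \<open>c + t b\<^sup>2\<close> is invertible in \<open>\<real>[b]\<close> for \<open>0 \<le> t \<le> 1\<close>, so \<open>\<Delta>\<close> has no zero on the
  segment from \<open>c\<close> to \<open>c + b\<^sup>2\<close>, and \<open>\<Delta>(c) = c\<^sup>r > 0\<close>.\<close>

section \<open>Power associativity\<close>

lemma jordan_distrib_left: "(c :: 'a::real_jordan_algebra) * (a + b) = c * a + c * b"
  by (metis jordan_distrib jordan_mult_commute)

lemma jordan_scaleR_left: "(b :: 'a::real_jordan_algebra) * (t *\<^sub>R a) = t *\<^sub>R (b * a)"
  by (metis jordan_scaleR jordan_mult_commute)

lemma jordan_unit_right: "(a :: 'a::real_jordan_algebra) * 1 = a"
  by (metis jordan_unit jordan_mult_commute)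

lemma jordan_zero: "0 * (a :: 'a::real_jordan_algebra) = 0"
  using jordan_scaleR[of 0 0 a] by simp

lemma jordan_zero_right: "(a :: 'a::real_jordan_algebra) * 0 = 0"
  by (metis jordan_zero jordan_mult_commute)

lemma jordan_minus: "(- (a :: 'a::real_jordan_algebra)) * b = - (a * b)"
  using jordan_scaleR[of "-1" a b] by simp

lemma jordan_minus_right: "(a :: 'a::real_jordan_algebra) * (- b) = - (a * b)"
  by (metis jordan_minus jordan_mult_commute)

lemma jordan_diff: "((a :: 'a::real_jordan_algebra) - b) * c = a * c - b * c"
  using jordan_distrib[of a "- b" c] by (simp add: jordan_minus)

lemma jordan_diff_right: "(c :: 'a::real_jordan_algebra) * (a - b) = c * a - c * b"
  by (metis jordan_diff jordan_mult_commute)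

lemmas jordan_linear_simps = jordan_distrib jordan_distrib_left jordan_scaleR jordan_scaleR_left
  jordan_minus jordan_minus_right jordan_diff jordan_diff_right

text \<open>Polarization of the Jordan identity, which is cubic in its first variable: the
  alternating sum of \<open>f\<close> over the partial sums of \<open>a + b + c\<close> keeps only
  the terms with one factor of each, and commutativity makes each of them occur twice.\<close>

lemma jordan_identity_linearized:
  "(a :: 'a::real_jordan_algebra) * ((b * c) * d) + b * ((c * a) * d) + c * ((a * b) * d) =
   (b * c) * (a * d) + (c * a) * (b * d) + (a * b) * (c * d)"
proof -
  define f where "f = (\<lambda>x. x * ((x * x) * d) - (x * x) * (x * d))"
  have f0: "f x = 0" for x
    by (simp add: f_def jordan_identity)
  have "f (a + b + c) - f (a + b) - f (a + c) - f (b + c) + f a + f b + f c =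
    2 *\<^sub>R (a * ((b * c) * d) + b * ((c * a) * d) + c * ((a * b) * d) -
     ((b * c) * (a * d) + (c * a) * (b * d) + (a * b) * (c * d)))"
    by (simp add: f_def jordan_distrib jordan_distrib_left scaleR_2 jordan_mult_commute[of b a]
        jordan_mult_commute[of c a] jordan_mult_commute[of c b] algebra_simps)
  then have "2 *\<^sub>R (a * ((b * c) * d) + b * ((c * a) * d) + c * ((a * b) * d) -
     ((b * c) * (a * d) + (c * a) * (b * d) + (a * b) * (c * d))) = 0"
    by (simp add: f0)
  then show ?thesis by simp
qed

text \<open>The right-hand side of the linearized identity is symmetric in all four variables; exchanging
  \<open>a\<close> and \<open>d\<close> on the left expresses the multiplication by \<open>(b * c) * d\<close> through multiplications by
  products of lower order.\<close>

lemma jordan_mult_triple: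
  "(((b :: 'a::real_jordan_algebra) * c) * d) * a =
     d * ((b * c) * a) + b * ((c * d) * a) + c * ((b * d) * a) - b * (d * (c * a)) - c * (d * (b * a))"
  using jordan_identity_linearized[of a b c d] jordan_identity_linearized[of d b c a]
  by (simp add: jordan_mult_commute algebra_simps)

text \<open>Strong induction with step two: \<open>jordan_mult_triple\<close> writes multiplication
  by \<open>x ^ Suc (Suc m)\<close> through multiplications by \<open>x\<close>,
  \<open>x * x\<close>, \<open>x ^ m\<close> and \<open>x ^ Suc m\<close>, so commutation with
  \<open>x\<close> and with \<open>x * x\<close> has to be carried along together.\<close>

lemma jordan_power_commute:
  "(x :: 'a::real_jordan_algebra) * (x ^ n * a) = x ^ n * (x * a) \<and> (x * x) * (x ^ n * a) = x ^ n * ((x * x) * a)"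
proof (induction n arbitrary: a rule: less_induct)
  case (less n)
  have sq: "x * ((x * x) * b) = (x * x) * (x * b)" for b
    by (rule jordan_identity)
  consider "n = 0" | "n = 1" | m where "n = Suc (Suc m)"
    by (metis One_nat_def not0_implies_Suc)
  then show ?case
  proof cases
    case 1
    then show ?thesis by (simp add: jordan_unit)
  next
    case 2
    then show ?thesis by (simp add: jordan_unit_right sq)
  next
    case 3
    have 1: "x * (x ^ m * b) = x ^ m * (x * b)" "(x * x) * (x ^ m * b) = x ^ m * ((x * x) * b)" for b
      using less.IH[of m] 3 by auto
    have 2: "x * (x ^ Suc m * b) = x ^ Suc m * (x * b)"
        "(x * x) * (x ^ Suc m * b) = x ^ Suc m * ((x * x) * b)" for b
      using less.IH[of "Suc m"] 3 by auto
    have eq: "x ^ n = (x ^ m * x) * x"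
      using 3 by (simp add: jordan_mult_commute)
    have pS: "x ^ m * x = x ^ Suc m"
      by (simp add: jordan_mult_commute)
    have step: "x ^ n * b = x * (x ^ Suc m * b) + x ^ m * ((x * x) * b) + x * (x ^ Suc m * b)
      - x ^ m * (x * (x * b)) - x * (x * (x ^ m * b))" for b
      unfolding eq jordan_mult_triple unfolding pS ..
    show ?thesis
      unfolding step
      by (simp only: jordan_linear_simps 1 2 sq[symmetric])
  qed
qed

lemma linear_jordan_mult: "linear ((*) (x :: 'a::real_jordan_algebra))"
  by (rule linearI) (simp_all add: jordan_distrib_left jordan_scaleR_left)

lemmas jordan_mult_sum = linear_sum[OF linear_jordan_mult]

lemma jordan_one_power: "(1 :: 'a::real_jordan_algebra) ^ n = 1"
  by (induction n) (simp_all add: jordan_unit)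

section \<open>Evaluation of polynomials and minimal polynomials\<close>

lemma jordan_eval_le:
  assumes "degree p \<le> n"
  shows "jordan_eval p x = (\<Sum>i\<le>n. coeff p i *\<^sub>R x ^ i)"
  unfolding jordan_eval_def
  using assms by (intro sum.mono_neutral_left) (auto simp: coeff_eq_0)

lemma jordan_eval_0 [simp]: "jordan_eval 0 x = 0"
  by (simp add: jordan_eval_def)

lemma jordan_eval_add: "jordan_eval (p + q) x = jordan_eval p x + jordan_eval q x"
proof -
  let ?n = "max (degree p) (degree q)"
  have "degree (p + q) \<le> ?n" by (rule degree_add_le_max)
  then show ?thesis
    by (simp add: jordan_eval_le[of _ ?n] scaleR_left_distrib sum.distrib)
qed

lemma jordan_eval_smult: "jordan_eval (smult c p) x = c *\<^sub>R jordan_eval p x"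
  by (simp add: jordan_eval_le[of "smult c p" "degree p"] jordan_eval_def scaleR_sum_right)

lemma jordan_eval_diff: "jordan_eval (p - q) x = jordan_eval p x - jordan_eval q x"
  using jordan_eval_add[of "p - q" q x] by simp

lemma jordan_eval_pCons: "jordan_eval (pCons c p) x = c *\<^sub>R 1 + x * jordan_eval p x"
proof -
  have "jordan_eval (pCons c p) x = (\<Sum>i\<le>Suc (degree p). coeff (pCons c p) i *\<^sub>R x ^ i)"
    by (rule jordan_eval_le) (rule degree_pCons_le)
  also have "\<dots> = c *\<^sub>R 1 + x * jordan_eval p x"
    by (subst sum.atMost_Suc_shift) (simp add: jordan_eval_def jordan_mult_sum jordan_scaleR_left)
  finally show ?thesis .
qed

lemma jordan_eval_1 [simp]: "jordan_eval 1 x = 1"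
  by (simp add: one_pCons jordan_eval_pCons jordan_zero_right)

lemma jordan_eval_monom: "jordan_eval (monom c n) x = c *\<^sub>R x ^ n"
  by (induction n) (simp_all add: monom_0 monom_Suc jordan_eval_pCons jordan_zero_right
      jordan_scaleR_left)

lemma jordan_eval_commute: "x * (jordan_eval p x * a) = jordan_eval p x * (x * a)"
proof -
  have "jordan_eval p x * b = (\<Sum>i\<le>degree p. coeff p i *\<^sub>R (x ^ i * b))" for b
    by (subst jordan_mult_commute) (simp add: jordan_eval_def jordan_mult_sum jordan_scaleR_left
        jordan_mult_commute[of b])
  then show ?thesis
    by (simp add: jordan_mult_sum jordan_scaleR_left jordan_power_commute)
qed

text \<open>Power associativity in the form used below: computations in the subalgebra generated by
  \<open>x\<close> reduce to identities between polynomials.\<close>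

lemma jordan_eval_mult: "jordan_eval (p * q) x = jordan_eval p x * jordan_eval q x"
proof (induction p rule: pCons_induct)
  case 0
  then show ?case by (simp add: jordan_zero)
next
  case (pCons c p)
  have "jordan_eval (pCons c p * q) x = c *\<^sub>R jordan_eval q x + x * (jordan_eval q x * jordan_eval p x)"
    using pCons by (simp add: mult_pCons_left jordan_eval_add jordan_eval_smult jordan_eval_pCons
        jordan_mult_commute)
  then show ?case
    by (simp add: jordan_eval_commute jordan_eval_pCons jordan_linear_simps jordan_unit
        jordan_mult_commute[of _ "jordan_eval q x"] jordan_unit_right)
qed

lemma jordan_eval_power: "jordan_eval (p ^ n) x = jordan_eval p x ^ n"
  by (induction n) (simp_all add: jordan_eval_mult)

lemma jordan_eval_pcompose: "jordan_eval (pcompose p q) x = jordan_eval p (jordan_eval q x)"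
  by (induction p rule: pCons_induct)
    (simp_all add: pcompose_pCons jordan_eval_add jordan_eval_mult jordan_eval_pCons jordan_zero_right)

section \<open>Degrees and minimal polynomials\<close>

lemma jordan_degree_le:
  assumes "p \<noteq> 0" "jordan_eval p x = 0"
  shows "jordan_degree x \<le> degree p"
  unfolding jordan_degree_def
proof (rule Least_le, intro exI conjI)
  show "lead_coeff (smult (1 / lead_coeff p) p) = 1" "degree (smult (1 / lead_coeff p) p) = degree p"
    using assms by auto
  show "jordan_eval (smult (1 / lead_coeff p) p) x = 0"
    using assms by (simp add: jordan_eval_smult)
qed

text \<open>There are \<open>DIM('a) + 1\<close> powers in a space of dimension
  \<open>DIM('a)\<close>. Coinciding powers are treated apart, since the set of powers is then too
  small for the count; a difference of two monomials serves instead.\<close>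

lemma jordan_powers_dependent:
  fixes x :: "'a::{euclidean_space, real_jordan_algebra}"
  shows "\<exists>p. p \<noteq> 0 \<and> degree p \<le> DIM('a) \<and> jordan_eval p x = 0"
proof (cases "inj_on (\<lambda>i. x ^ i) {..DIM('a)}")
  case True
  let ?S = "(\<lambda>i. x ^ i) ` {..DIM('a)}"
  have "card ?S = Suc (DIM('a))"
    using True by (simp add: card_image)
  then have "dependent ?S"
    by (intro dependent_biggerset) auto
  then obtain u where u: "(\<exists>v\<in>?S. u v \<noteq> 0)" "(\<Sum>v\<in>?S. u v *\<^sub>R v) = 0"
    using dependent_finite[of ?S] by auto
  define p where "p = (\<Sum>i\<le>DIM('a). monom (u (x ^ i)) i)"
  have cp: "coeff p i = (if i \<le> DIM('a) then u (x ^ i) else 0)" for i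
    by (simp add: p_def coeff_sum)
  have d: "degree p \<le> DIM('a)"
    by (rule degree_le) (simp add: cp)
  have "jordan_eval p x = (\<Sum>i\<le>DIM('a). u (x ^ i) *\<^sub>R x ^ i)"
    by (simp add: jordan_eval_le[OF d] cp)
  also have "\<dots> = 0"
    using u(2) True by (simp add: sum.reindex)
  finally have "jordan_eval p x = 0" .
  moreover have "p \<noteq> 0"
    using u(1) cp by (metis (no_types, lifting) atMost_iff coeff_0 imageE)
  ultimately show ?thesis using d by blast
next
  case False
  then obtain i j where ij: "i \<le> DIM('a)" "j \<le> DIM('a)" "i \<noteq> j" "x ^ i = x ^ j"
    by (auto simp: inj_on_def)
  let ?p = "monom 1 i - monom (1::real) j"
  have "coeff ?p i = 1"
    using ij by simp
  then have "?p \<noteq> 0" by (metis coeff_0 zero_neq_one)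
  moreover have "degree ?p \<le> DIM('a)"
    using ij by (intro degree_diff_le) (auto simp: degree_monom_eq)
  moreover have "jordan_eval ?p x = 0"
    using ij by (simp add: jordan_eval_diff jordan_eval_monom)
  ultimately show ?thesis by blast
qed

lemma jordan_minpoly_exists:
  fixes x :: "'a::{euclidean_space, real_jordan_algebra}"
  shows "\<exists>p. lead_coeff p = 1 \<and> degree p = jordan_degree x \<and> jordan_eval p x = 0"
proof -
  obtain p where p: "p \<noteq> 0" "jordan_eval p x = 0"
    using jordan_powers_dependent by blast
  have "lead_coeff (smult (1 / lead_coeff p) p) = 1" "jordan_eval (smult (1 / lead_coeff p) p) x = 0"
    using p by (simp_all add: jordan_eval_smult)
  then show ?thesis
    unfolding jordan_degree_def
    by (intro LeastI_ex[where P = "\<lambda>k. \<exists>p. lead_coeff p = 1 \<and> degree p = k \<and> jordan_eval p x = 0"])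
      blast
qed

text \<open>Two monic annihilators of least degree differ by an annihilator of smaller degree, which
  must be 0. This makes the \<open>THE\<close> in \<open>jordan_minpoly\<close> usable.\<close>

lemma jordan_minpoly_eqI:
  fixes x :: "'a::real_jordan_algebra"
  assumes "lead_coeff p = 1" "degree p = jordan_degree x" "jordan_eval p x = 0"
  shows "jordan_minpoly x = p"
  unfolding jordan_minpoly_def
proof (rule the_equality)
  fix q :: "real poly"
  assume q: "lead_coeff q = 1 \<and> degree q = jordan_degree x \<and> jordan_eval q x = 0"
  show "q = p"
  proof (rule ccontr)
    assume ne: "q \<noteq> p"
    have "jordan_degree x \<le> degree (q - p)"
      using ne q assms by (intro jordan_degree_le) (auto simp: jordan_eval_diff)
    moreover have "coeff (q - p) (jordan_degree x) = 0"
      using q assms by (metis coeff_diff diff_self)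
    moreover have "degree (q - p) \<le> jordan_degree x"
      using q assms by (intro degree_diff_le) auto
    ultimately have "lead_coeff (q - p) = 0"
      by simp
    then show False using ne by (simp only: leading_coeff_0_iff right_minus_eq)
  qed
qed (use assms in auto)

lemma
  fixes x :: "'a::{euclidean_space, real_jordan_algebra}"
  shows lead_coeff_jordan_minpoly: "lead_coeff (jordan_minpoly x) = 1"
    and degree_jordan_minpoly: "degree (jordan_minpoly x) = jordan_degree x"
    and jordan_eval_minpoly: "jordan_eval (jordan_minpoly x) x = 0"
proof -
  obtain p where p: "lead_coeff p = 1" "degree p = jordan_degree x" "jordan_eval p x = 0"
    using jordan_minpoly_exists by blast
  then show "lead_coeff (jordan_minpoly x) = 1" "degree (jordan_minpoly x) = jordan_degree x"
    "jordan_eval (jordan_minpoly x) x = 0"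
    by (simp_all add: jordan_minpoly_eqI[OF p])
qed

lemma jordan_degree_le_DIM:
  "jordan_degree (x :: 'a::{euclidean_space, real_jordan_algebra}) \<le> DIM('a)"
  using jordan_powers_dependent[of x] jordan_degree_le order_trans by blast

text \<open>A monic polynomial of degree 0 is 1, and it evaluates to \<open>1\<close>, which is
  nonzero in a simple algebra. Ranks are therefore positive, so that later divisions by them are
  genuine.\<close>

lemma jordan_degree_pos:
  fixes x :: "'a::{euclidean_space, simple_real_jordan_algebra}"
  shows "0 < jordan_degree x"
proof (rule ccontr)
  assume "\<not> ?thesis"
  then have "degree (jordan_minpoly x) = 0"
    by (simp add: degree_jordan_minpoly)
  moreover have "lead_coeff (jordan_minpoly x) = 1"
    by (rule lead_coeff_jordan_minpoly)
  ultimately have "degree (jordan_minpoly x) = 0" "coeff (jordan_minpoly x) 0 = 1"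
    by simp_all
  then have "jordan_minpoly x = 1"
    by (metis degree_eq_zeroE coeff_pCons_0 one_pCons)
  then show False
    using jordan_eval_minpoly[of x] jordan_nontrivial[where 'a='a] by simp
qed

lemma finite_jordan_degrees:
  "finite (jordan_degree ` (S :: 'a::{euclidean_space, real_jordan_algebra} set))"
  by (rule finite_subset[of _ "{..DIM('a)}"]) (auto simp: jordan_degree_le_DIM)

lemma jordan_degree_le_rank:
  fixes S :: "'a::{euclidean_space, real_jordan_algebra} set"
  shows "x \<in> S \<Longrightarrow> jordan_degree x \<le> jordan_rank S"
  unfolding jordan_rank_def by (intro Max_ge finite_jordan_degrees imageI)

lemma jordan_rank_pos:
  fixes S :: "'a::{euclidean_space, simple_real_jordan_algebra} set"
  shows "x \<in> S \<Longrightarrow> 0 < jordan_rank S"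
  using jordan_degree_le_rank[of x S] jordan_degree_pos[of x] by linarith

lemma jordan_regular_exists: "\<exists>x :: 'a::{euclidean_space, real_jordan_algebra}. jordan_regular x"
proof -
  have "jordan_rank (UNIV :: 'a set) \<in> jordan_degree ` (UNIV :: 'a set)"
    unfolding jordan_rank_def by (intro Max_in finite_jordan_degrees) auto
  then show ?thesis
    unfolding jordan_regular_def by (metis imageE)
qed

section \<open>Polynomial functions on a Jordan algebra\<close>

lemma bounded_bilinear_jordan_mult:
  "bounded_bilinear ((*) :: 'a::{euclidean_space, real_jordan_algebra} \<Rightarrow> 'a \<Rightarrow> 'a)"
  unfolding bilinear_conv_bounded_bilinear[symmetric] bilinear_def
  by (auto intro!: linearI simp: jordan_linear_simps)

lemma polynomial_function_jordan_mult:
  fixes f g :: "'b::real_normed_vector \<Rightarrow> 'a::{euclidean_space, real_jordan_algebra}"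
  assumes "polynomial_function f" "polynomial_function g"
  shows "polynomial_function (\<lambda>x. f x * g x)"
proof -
  interpret bounded_bilinear "(*) :: 'a \<Rightarrow> 'a \<Rightarrow> 'a"
    by (rule bounded_bilinear_jordan_mult)
  have exp: "u * v = (\<Sum>c\<in>Basis. \<Sum>d\<in>Basis. ((u \<bullet> c) * (v \<bullet> d)) *\<^sub>R (c * d))" for u v :: 'a
  proof -
    have "u * v = (\<Sum>c\<in>Basis. (u \<bullet> c) *\<^sub>R c) * (\<Sum>d\<in>Basis. (v \<bullet> d) *\<^sub>R d)"
      by (simp add: euclidean_representation)
    also have "\<dots> = (\<Sum>c\<in>Basis. \<Sum>d\<in>Basis. ((u \<bullet> c) *\<^sub>R c) * ((v \<bullet> d) *\<^sub>R d))"
      by (simp only: sum_left) (simp only: sum_right)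
    finally show ?thesis
      by (simp add: jordan_scaleR jordan_scaleR_left mult.commute)
  qed
  have "real_polynomial_function (\<lambda>x. f x \<bullet> c)" "real_polynomial_function (\<lambda>x. g x \<bullet> c)" for c
    using assms bounded_linear_inner_left[of c]
    unfolding polynomial_function_def by (auto simp: o_def)
  then have "polynomial_function (\<lambda>x. f x \<bullet> c)" "polynomial_function (\<lambda>x. g x \<bullet> c)" for c
    by (simp_all add: real_polynomial_function_eq)
  then have "polynomial_function
      (\<lambda>x. \<Sum>c\<in>Basis. \<Sum>d\<in>Basis. ((f x \<bullet> c) * (g x \<bullet> d)) *\<^sub>R (c * d))"
    by (intro polynomial_function_sum polynomial_function_mult[where f = "\<lambda>x. (f x \<bullet> _) * (g x \<bullet> _)"]
        polynomial_function_const polynomial_function_mult[where g = "\<lambda>x. g x \<bullet> _", unfolded real_scaleR_def]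
        finite_Basis)
  moreover have "(\<lambda>x. f x * g x) =
      (\<lambda>x. \<Sum>c\<in>Basis. \<Sum>d\<in>Basis. ((f x \<bullet> c) * (g x \<bullet> d)) *\<^sub>R (c * d))"
    by (intro ext exp)
  ultimately show ?thesis by simp
qed

lemma polynomial_function_jordan_eval:
  fixes f :: "'b::real_normed_vector \<Rightarrow> 'a::{euclidean_space, real_jordan_algebra}"
  assumes "polynomial_function f"
  shows "polynomial_function (\<lambda>x. jordan_eval p (f x))"
  using assms
  by (induction p rule: pCons_induct)
    (auto simp: jordan_eval_pCons intro!: polynomial_function_jordan_mult)

lemma polynomial_function_jordan_power:
  "polynomial_function (\<lambda>x :: 'a::{euclidean_space, real_jordan_algebra}. x ^ n)"
  using polynomial_function_jordan_eval[OF polynomial_function_id, of "monom 1 n"]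
  by (simp add: jordan_eval_monom)

section \<open>Zero sets of polynomials and density of the regular elements\<close>

lemma real_polynomial_function_imp_poly:
  assumes "real_polynomial_function (f :: real \<Rightarrow> real)"
  obtains q where "\<And>t. f t = poly q t"
proof -
  obtain a n where f: "f = (\<lambda>x. \<Sum>i\<le>n. a i * x ^ i)"
    using assms by (auto simp: real_polynomial_function_iff_sum)
  have "f t = poly (\<Sum>i\<le>n. monom (a i) i) t" for t
    by (simp add: f poly_sum poly_monom)
  then show thesis by (rule that)
qed

text \<open>On the line from \<open>x\<close> to \<open>x0\<close> the function becomes a polynomial
  in \<open>t\<close> that is nonzero at \<open>t = 1\<close>; its finitely many roots leave
  arbitrarily small \<open>t > 0\<close> with a nonzero value.\<close>

lemma closure_real_polynomial_nonzero:
  fixes p :: "'a::real_normed_vector \<Rightarrow> real"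
  assumes p: "real_polynomial_function p" and x0: "p x0 \<noteq> 0"
  shows "closure {x. p x \<noteq> 0} = UNIV"
proof -
  have "\<exists>y. p y \<noteq> 0 \<and> dist y x < e" if "e > 0" for x e
  proof -
    have "polynomial_function (\<lambda>t. x + t *\<^sub>R (x0 - x))"
      by (intro polynomial_function_add polynomial_function_const polynomial_function_mult
          polynomial_function_id)
    then have "real_polynomial_function (p \<circ> (\<lambda>t. x + t *\<^sub>R (x0 - x)))"
      by (rule real_polynomial_function_compose[OF _ p])
    then obtain q where q: "\<And>t. p (x + t *\<^sub>R (x0 - x)) = poly q t"
      by (elim real_polynomial_function_imp_poly) (auto simp: o_def)
    have "poly q 1 \<noteq> 0" using q[of 1] x0 by simp
    then have "finite {t. poly q t = 0}"
      by (intro poly_roots_finite) auto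
    define d where "d = e / (norm (x0 - x) + 1)"
    have "d > 0" using that by (simp add: d_def add_nonneg_pos)
    then have "infinite {0<..<d}" by simp
    with \<open>finite {t. poly q t = 0}\<close> have "\<not> {0<..<d} \<subseteq> {t. poly q t = 0}"
      using finite_subset by blast
    then obtain t where t: "0 < t" "t < d" "poly q t \<noteq> 0"
      unfolding subset_iff greaterThanLessThan_iff mem_Collect_eq by blast
    have "t * norm (x0 - x) \<le> t * (norm (x0 - x) + 1)"
      using t by simp
    also have "\<dots> < d * (norm (x0 - x) + 1)"
      using t by (intro mult_strict_right_mono) (auto simp: add_nonneg_pos)
    also have "\<dots> = e"
      using norm_ge_zero[of "x0 - x"] by (simp add: d_def add_nonneg_eq_0_iff)
    finally have "dist (x + t *\<^sub>R (x0 - x)) x < e"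
      using t by (simp add: dist_norm)
    then show ?thesis using t q by metis
  qed
  then show ?thesis
    by (auto simp: closure_approachable)
qed

text \<open>Gaussian elimination with polynomial pivots.\<close>

lemma polynomial_independence_locus:
  fixes v :: "nat \<Rightarrow> 'a::euclidean_space \<Rightarrow> 'b::euclidean_space"
  assumes "\<And>i. i < k \<Longrightarrow> polynomial_function (v i)"
    and "\<And>c. (\<Sum>i<k. c i *\<^sub>R v i x0) = 0 \<Longrightarrow> \<forall>i<k. c i = 0"
  shows "\<exists>D. real_polynomial_function D \<and> D x0 \<noteq> 0 \<and>
           (\<forall>x c. D x \<noteq> 0 \<longrightarrow> (\<Sum>i<k. c i *\<^sub>R v i x) = 0 \<longrightarrow> (\<forall>i<k. c i = 0))"
  using assms
proof (induction k arbitrary: v)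
  case 0
  show ?case
    by (rule exI[of _ "\<lambda>_. 1"]) auto
next
  case (Suc k)
  have "v k x0 \<noteq> 0"
  proof
    assume "v k x0 = 0"
    then have "(\<Sum>i<Suc k. (if i = k then 1 else 0) *\<^sub>R v i x0) = 0"
      by (intro sum.neutral) auto
    from Suc.prems(2)[OF this] show False by auto
  qed
  then obtain b where b: "v k x0 \<bullet> b \<noteq> 0"
    by (metis inner_eq_zero_iff)
  define D1 where "D1 = (\<lambda>x. v k x \<bullet> b)"
  \<comment> \<open>Elimination without division: \<open>w i x\<close> is orthogonal to
    \<open>b\<close>, and it stays polynomial in \<open>x\<close>.\<close>
  define w where "w = (\<lambda>i x. D1 x *\<^sub>R v i x - (v i x \<bullet> b) *\<^sub>R v k x)"
  have inner: "real_polynomial_function (\<lambda>x. v i x \<bullet> b)" if "i < Suc k" for i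
    using Suc.prems(1)[OF that] bounded_linear_inner_left[of b]
    unfolding polynomial_function_def by (auto simp: o_def)
  have wsum: "(\<Sum>i<k. c i *\<^sub>R w i x) = D1 x *\<^sub>R (\<Sum>i<k. c i *\<^sub>R v i x)
      - ((\<Sum>i<k. c i *\<^sub>R v i x) \<bullet> b) *\<^sub>R v k x" for c x
    by (simp add: w_def scaleR_sum_right inner_sum_left scaleR_sum_left sum_subtractf
        scaleR_diff_right mult.commute)
  have "\<exists>D. real_polynomial_function D \<and> D x0 \<noteq> 0 \<and>
           (\<forall>x c. D x \<noteq> 0 \<longrightarrow> (\<Sum>i<k. c i *\<^sub>R w i x) = 0 \<longrightarrow> (\<forall>i<k. c i = 0))"
  proof (rule Suc.IH)
    show "polynomial_function (w i)" if "i < k" for i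
      unfolding w_def D1_def
      using Suc.prems(1) inner that less_SucI
      by (intro polynomial_function_diff polynomial_function_mult)
        (auto simp: real_polynomial_function_eq[symmetric])
    fix c assume c: "(\<Sum>i<k. c i *\<^sub>R w i x0) = 0"
    \<comment> \<open>A relation among the \<open>w i\<close> at \<open>x0\<close> lifts to one
      among all \<open>v i\<close>; the last coefficient compensates the subtracted multiples of
      \<open>v k\<close>.\<close>
    define c' where "c' = (\<lambda>i. if i < k then D1 x0 * c i else - ((\<Sum>i<k. c i *\<^sub>R v i x0) \<bullet> b))"
    have "(\<Sum>i<Suc k. c' i *\<^sub>R v i x0) = (\<Sum>i<k. (D1 x0 * c i) *\<^sub>R v i x0) + c' k *\<^sub>R v k x0"
      by (simp add: c'_def)
    also have "\<dots> = 0"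
      using c by (simp add: wsum c'_def scaleR_sum_right)
    finally have "\<forall>i<Suc k. c' i = 0"
      by (rule Suc.prems(2))
    then show "\<forall>i<k. c i = 0"
      using b by (auto simp: c'_def D1_def less_Suc_eq)
  qed
  then obtain D2 where D2: "real_polynomial_function D2" "D2 x0 \<noteq> 0"
      "\<And>x c. D2 x \<noteq> 0 \<Longrightarrow> (\<Sum>i<k. c i *\<^sub>R w i x) = 0 \<Longrightarrow> \<forall>i<k. c i = 0"
    by blast
  show ?case
  proof (intro exI[of _ "\<lambda>x. D1 x * D2 x"] conjI allI impI)
    show "real_polynomial_function (\<lambda>x. D1 x * D2 x)"
      unfolding D1_def using D2(1) inner by auto
    show "D1 x0 * D2 x0 \<noteq> 0"
      using b D2 by (simp add: D1_def)
    fix x c i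
    assume D: "D1 x * D2 x \<noteq> 0" and c: "(\<Sum>i<Suc k. c i *\<^sub>R v i x) = 0" and i: "i < Suc k"
    have s: "(\<Sum>i<k. c i *\<^sub>R v i x) = - (c k *\<^sub>R v k x)"
      using c by (simp add: add_eq_0_iff2)
    have "(\<Sum>i<k. c i *\<^sub>R w i x) = 0"
      unfolding wsum s by (simp add: D1_def)
    with D have *: "\<forall>i<k. c i = 0"
      using D2(3) by auto
    then have "c k *\<^sub>R v k x = 0"
      using s by simp
    moreover have "v k x \<noteq> 0"
      using D by (auto simp: D1_def)
    ultimately show "c i = 0"
      using * i by (auto simp: less_Suc_eq)
  qed
qed

text \<open>Relations between the powers below the rank correspond to annihilating polynomials of
  degree below the rank. In this form regularity is accessible to
  \<open>polynomial_independence_locus\<close>.\<close>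

lemma jordan_regular_iff_independent:
  fixes x :: "'a::{euclidean_space, real_jordan_algebra}"
  shows "jordan_regular x \<longleftrightarrow>
    (\<forall>c. (\<Sum>i<jordan_rank (UNIV :: 'a set). c i *\<^sub>R x ^ i) = 0 \<longrightarrow>
      (\<forall>i<jordan_rank (UNIV :: 'a set). c i = 0))" (is "_ = (\<forall>c. ?P c)")
proof
  let ?r = "jordan_rank (UNIV :: 'a set)"
  assume reg: "jordan_regular x"
  show "\<forall>c. ?P c"
  proof (intro allI impI, rule ccontr)
    fix c i assume c: "(\<Sum>i<?r. c i *\<^sub>R x ^ i) = 0" and i: "i < ?r" and ne: "c i \<noteq> 0"
    define p where "p = (\<Sum>i<?r. monom (c i) i)"
    have cp: "coeff p i = (if i < ?r then c i else 0)" for i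
      by (simp add: p_def coeff_sum)
    have "p \<noteq> 0" using ne i cp by (metis coeff_0)
    have d: "degree p \<le> ?r - 1"
      by (rule degree_le) (auto simp: cp)
    have "jordan_eval p x = (\<Sum>i\<le>?r - 1. coeff p i *\<^sub>R x ^ i)"
      by (rule jordan_eval_le[OF d])
    also have "\<dots> = (\<Sum>i<?r. c i *\<^sub>R x ^ i)"
      using i by (intro sum.cong) (auto simp: cp)
    finally have "jordan_degree x \<le> degree p"
      using c \<open>p \<noteq> 0\<close> by (intro jordan_degree_le) auto
    then show False using d i reg by (simp add: jordan_regular_def)
  qed
next
  let ?r = "jordan_rank (UNIV :: 'a set)"
  assume ind: "\<forall>c. ?P c"
  show "jordan_regular x"
  proof (rule ccontr)
    assume "\<not> jordan_regular x"
    then have d: "jordan_degree x < ?r"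
      using jordan_degree_le_rank[of x UNIV] by (simp add: jordan_regular_def)
    let ?p = "jordan_minpoly x"
    have "(\<Sum>i<?r. coeff ?p i *\<^sub>R x ^ i) = (\<Sum>i\<le>?r - 1. coeff ?p i *\<^sub>R x ^ i)"
      using d by (intro sum.cong) auto
    also have "\<dots> = jordan_eval ?p x"
      using d by (intro jordan_eval_le[symmetric]) (simp add: degree_jordan_minpoly)
    finally have "coeff ?p (degree ?p) = 0"
      using ind d by (simp add: jordan_eval_minpoly degree_jordan_minpoly)
    then show False
      by (simp add: lead_coeff_jordan_minpoly)
  qed
qed

lemma jordan_regular_polynomial_locus:
  obtains D :: "'a::{euclidean_space, real_jordan_algebra} \<Rightarrow> real" and x0
  where "real_polynomial_function D" "D x0 \<noteq> 0" "\<And>x. D x \<noteq> 0 \<Longrightarrow> jordan_regular x"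
proof -
  obtain x0 :: 'a where x0: "jordan_regular x0"
    using jordan_regular_exists by blast
  let ?r = "jordan_rank (UNIV :: 'a set)"
  have "\<exists>D :: 'a \<Rightarrow> real. real_polynomial_function D \<and> D x0 \<noteq> 0 \<and>
      (\<forall>x c. D x \<noteq> 0 \<longrightarrow> (\<Sum>i<?r. c i *\<^sub>R x ^ i) = 0 \<longrightarrow> (\<forall>i<?r. c i = 0))"
    using x0 unfolding jordan_regular_iff_independent
    by (intro polynomial_independence_locus[of ?r "\<lambda>i x. x ^ i"] polynomial_function_jordan_power) auto
  then show thesis
    using that by (auto simp: jordan_regular_iff_independent)
qed

text \<open>The nonvanishing set of the regularity polynomial \<open>D\<close> is dense and that of
  \<open>h\<close> is open and nonempty, so they meet; hence \<open>D * h\<close> is not identically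
  zero and its nonvanishing set is dense too.\<close>

lemma closure_jordan_regular_nonzero:
  fixes h :: "'a::{euclidean_space, real_jordan_algebra} \<Rightarrow> real"
  assumes h: "real_polynomial_function h" and y: "h y \<noteq> 0"
  shows "closure {x. jordan_regular x \<and> h x \<noteq> 0} = UNIV"
proof -
  obtain D :: "'a \<Rightarrow> real" and x0 where D: "real_polynomial_function D" "D x0 \<noteq> 0"
      "\<And>x. D x \<noteq> 0 \<Longrightarrow> jordan_regular x"
    by (rule jordan_regular_polynomial_locus) blast
  have "open {x. h x \<noteq> 0}"
    using h by (intro open_Collect_neq continuous_on_const continuous_on_polymonial_function)
      (simp add: real_polynomial_function_eq)
  moreover have "y \<in> closure {x. D x \<noteq> 0}"
    using closure_real_polynomial_nonzero[OF D(1,2)] by simp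
  ultimately obtain z where "D z \<noteq> 0" "h z \<noteq> 0"
    using y open_Int_closure_eq_empty[of "{x. h x \<noteq> 0}" "{x. D x \<noteq> 0}"] by blast
  then have "closure {x. D x * h x \<noteq> 0} = UNIV"
    using D h by (intro closure_real_polynomial_nonzero) auto
  moreover have "{x. D x * h x \<noteq> 0} \<subseteq> {x. jordan_regular x \<and> h x \<noteq> 0}"
    using D(3) by auto
  ultimately show ?thesis
    using closure_mono by blast
qed

text \<open>\<open>is_jordan_det\<close> prescribes values at regular elements only; this extension
  principle carries identities for the determinant to the whole algebra. By density,
  \<open>f - g\<close> cannot be nonzero anywhere without being nonzero at a regular
  element.\<close>

lemma real_polynomial_eq_of_regular:
  fixes f g :: "'a::{euclidean_space, real_jordan_algebra} \<Rightarrow> real"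
  assumes f: "real_polynomial_function f" and g: "real_polynomial_function g"
    and eq: "\<And>x. jordan_regular x \<Longrightarrow> f x = g x"
  shows "f x = g x"
proof (rule ccontr)
  assume "f x \<noteq> g x"
  then have "closure {x. jordan_regular x \<and> f x - g x \<noteq> 0} = UNIV"
    using f g by (intro closure_jordan_regular_nonzero[of _ x]) auto
  moreover have "{x. jordan_regular x \<and> f x - g x \<noteq> 0} = {}"
    using eq by auto
  ultimately show False by (metis closure_empty UNIV_not_empty)
qed

section \<open>The Jordan determinant\<close>

text \<open>Composition with the inverse affine map \<open>[:- b / a, 1 / a:]\<close> turns
  annihilators of \<open>x\<close> into annihilators of its image. The same argument for the inverse
  map gives equality of degrees; the factor \<open>a ^ jordan_degree x\<close> makes the result
  monic.\<close>

lemma jordan_minpoly_affine: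
  fixes x :: "'a::{euclidean_space, real_jordan_algebra}"
  assumes a: "a \<noteq> 0"
  shows "jordan_degree (b *\<^sub>R 1 + a *\<^sub>R x) = jordan_degree x" (is ?deg)
    and "jordan_minpoly (b *\<^sub>R 1 + a *\<^sub>R x) =
      smult (a ^ jordan_degree x) (pcompose (jordan_minpoly x) [:- b / a, 1 / a:])" (is ?min)
proof -
  have le: "jordan_degree (b *\<^sub>R 1 + a *\<^sub>R x) \<le> jordan_degree x \<and>
      jordan_eval (pcompose (jordan_minpoly x) [:- b / a, 1 / a:]) (b *\<^sub>R 1 + a *\<^sub>R x) = 0"
    if "a \<noteq> 0" for a b and x :: 'a
  proof -
    let ?y = "b *\<^sub>R 1 + a *\<^sub>R x" and ?q = "pcompose (jordan_minpoly x) [:- b / a, 1 / a:]"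
    have "jordan_eval [:- b / a, 1 / a:] ?y = x"
      using that by (simp add: jordan_eval_pCons jordan_zero_right jordan_linear_simps
          jordan_unit_right algebra_simps)
    then have 0: "jordan_eval ?q ?y = 0"
      by (simp add: jordan_eval_pcompose jordan_eval_minpoly)
    have "jordan_minpoly x \<noteq> 0"
      using lead_coeff_jordan_minpoly[of x] by auto
    then have "?q \<noteq> 0"
      using that by (simp add: pcompose_eq_0_iff)
    then have "jordan_degree ?y \<le> degree ?q"
      using 0 by (rule jordan_degree_le)
    then show ?thesis
      using 0 that by (simp add: degree_pcompose degree_jordan_minpoly)
  qed
  let ?y = "b *\<^sub>R 1 + a *\<^sub>R x"
  have "x = (- b / a) *\<^sub>R 1 + (1 / a) *\<^sub>R ?y"
    using a by (simp add: algebra_simps)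
  then have "jordan_degree x \<le> jordan_degree ?y"
    using le[of "1 / a" "- b / a" ?y] a by simp
  then show deg: ?deg
    using le[OF a, of b x] by simp
  show ?min
  proof (rule jordan_minpoly_eqI)
    let ?q = "pcompose (jordan_minpoly x) [:- b / a, 1 / a:]"
    have d: "degree ?q = jordan_degree x"
      using a by (simp add: degree_pcompose degree_jordan_minpoly)
    then show "degree (smult (a ^ jordan_degree x) ?q) = jordan_degree ?y"
      using a deg by simp
    have "lead_coeff ?q = lead_coeff (jordan_minpoly x) * (1 / a) ^ degree (jordan_minpoly x)"
      using a by (subst lead_coeff_comp) auto
    also have "\<dots> = (1 / a) ^ jordan_degree x"
      unfolding lead_coeff_jordan_minpoly by (simp add: degree_jordan_minpoly)
    finally have "lead_coeff ?q = (1 / a) ^ jordan_degree x" .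
    then show "lead_coeff (smult (a ^ jordan_degree x) ?q) = 1"
      using a by (simp add: power_divide)
    show "jordan_eval (smult (a ^ jordan_degree x) ?q) ?y = 0"
      using le[OF a, of b x] by (simp add: jordan_eval_smult)
  qed
qed

lemma is_jordan_det_continuous: "is_jordan_det \<Delta> \<Longrightarrow> continuous_on S \<Delta>"
  unfolding is_jordan_det_def
  by (intro continuous_on_polymonial_function) (simp add: real_polynomial_function_eq)

lemma jordan_det_compose_polynomial:
  "is_jordan_det \<Delta> \<Longrightarrow> polynomial_function f \<Longrightarrow> real_polynomial_function (\<lambda>x. \<Delta> (f x))"
  unfolding is_jordan_det_def
  using real_polynomial_function_compose[of f \<Delta>] by (simp add: o_def)

text \<open>The constant coefficient of the transformed minimal polynomial is a multiple of the
  value of the original one at \<open>- b / a\<close>. The case \<open>b = 0\<close> serves for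
  homogeneity, \<open>b = 1\<close> for the value at the unit.\<close>

lemma jordan_det_affine_regular:
  fixes x :: "'a::{euclidean_space, real_jordan_algebra}"
  assumes "is_jordan_det \<Delta>" "jordan_regular x" "a \<noteq> 0"
  shows "\<Delta> (b *\<^sub>R 1 + a *\<^sub>R x) =
    (- a) ^ jordan_rank (UNIV :: 'a set) * poly (jordan_minpoly x) (- b / a)"
proof -
  have "jordan_regular (b *\<^sub>R 1 + a *\<^sub>R x)"
    using assms by (simp add: jordan_regular_def jordan_minpoly_affine)
  then have "\<Delta> (b *\<^sub>R 1 + a *\<^sub>R x) = (- 1) ^ jordan_rank (UNIV :: 'a set) *
      coeff (jordan_minpoly (b *\<^sub>R 1 + a *\<^sub>R x)) 0"
    using assms by (simp add: is_jordan_det_def)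
  also have "\<dots> = (- 1) ^ jordan_rank (UNIV :: 'a set) * a ^ jordan_degree x *
      poly (jordan_minpoly x) (- b / a)"
    using assms by (simp add: jordan_minpoly_affine poly_0_coeff_0[symmetric] poly_pcompose)
  finally show ?thesis
    using assms by (simp add: jordan_regular_def power_mult_distrib[symmetric])
qed

lemma jordan_det_scaleR:
  fixes \<Delta> :: "'a::{euclidean_space, real_jordan_algebra} \<Rightarrow> real"
  assumes \<Delta>: "is_jordan_det \<Delta>" and c: "c \<noteq> 0"
  shows "\<Delta> (c *\<^sub>R x) = c ^ jordan_rank (UNIV :: 'a set) * \<Delta> x"
proof (rule real_polynomial_eq_of_regular[of "\<lambda>x. \<Delta> (c *\<^sub>R x)" "\<lambda>x. _ * \<Delta> x"])
  show "real_polynomial_function (\<lambda>x. \<Delta> (c *\<^sub>R x))"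
    by (intro jordan_det_compose_polynomial[OF \<Delta>] polynomial_function_cmul polynomial_function_id)
  show "real_polynomial_function (\<lambda>x. c ^ jordan_rank (UNIV :: 'a set) * \<Delta> x)"
    using \<Delta> by (auto simp: is_jordan_det_def)
  fix x :: 'a
  assume "jordan_regular x"
  then show "\<Delta> (c *\<^sub>R x) = c ^ jordan_rank (UNIV :: 'a set) * \<Delta> x"
    using jordan_det_affine_regular[OF \<Delta> _ c, of x 0] jordan_det_affine_regular[OF \<Delta>, of x 1 0]
    by (simp add: power_mult_distrib[symmetric])
qed

text \<open>For regular \<open>x\<close> with minimal polynomial \<open>p\<close>, \<open>\<Delta>(1 + a x) = (- a)\<^sup>r p(- 1 / a)\<close> is the value at
  \<open>- a\<close> of the reversed polynomial of \<open>p\<close>, which tends to the leading coefficient as \<open>a\<close> tends to 0.\<close>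

lemma jordan_det_one:
  fixes \<Delta> :: "'a::{euclidean_space, real_jordan_algebra} \<Rightarrow> real"
  assumes \<Delta>: "is_jordan_det \<Delta>"
  shows "\<Delta> 1 = 1"
proof -
  obtain x :: 'a where x: "jordan_regular x"
    using jordan_regular_exists by blast
  let ?p = "jordan_minpoly x"
  define h where "h = (\<lambda>a::real. \<Delta> (1 + a *\<^sub>R x) - poly (reflect_poly ?p) (- a))"
  have zero: "h a = 0" if "a \<noteq> 0" for a
  proof -
    have "poly (reflect_poly ?p) (- a) = (- a) ^ degree ?p * poly ?p (- 1 / a)"
      using that by (simp add: poly_reflect_poly_nz divide_inverse)
    then show ?thesis
      using jordan_det_affine_regular[OF \<Delta> x that, of 1] x
      by (simp add: h_def jordan_regular_def degree_jordan_minpoly)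
  qed
  have cont: "continuous_on UNIV h"
    unfolding h_def
    by (intro continuous_intros continuous_on_compose2[OF is_jordan_det_continuous[OF \<Delta>, of UNIV]]) auto
  have cl: "closure (- {0 :: real}) = UNIV"
    by (simp add: closure_complement)
  have "h 0 = 0"
  proof (rule continuous_constant_on_closure[of "- {0}" h 0])
    show "continuous_on (closure (- {0})) h"
      unfolding cl by (rule cont)
    show "\<And>a. a \<in> - {0} \<Longrightarrow> h a = 0"
      using zero by blast
    show "0 \<in> closure (- {0 :: real})"
      unfolding cl by (rule UNIV_I)
  qed
  then have "\<Delta> 1 = lead_coeff ?p"
    by (simp add: h_def)
  then show ?thesis
    unfolding lead_coeff_jordan_minpoly .
qed

text \<open>An injective homomorphism fixing the unit preserves annihilating polynomials in both
  directions, hence minimal polynomials and regularity.\<close>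

lemma jordan_det_automorphism:
  fixes \<Delta> :: "'a::{euclidean_space, real_jordan_algebra} \<Rightarrow> real"
  assumes \<Delta>: "is_jordan_det \<Delta>" and lin: "linear \<phi>" and inj: "inj \<phi>"
    and hom: "\<And>x y. \<phi> (x * y) = \<phi> x * \<phi> y" and one: "\<phi> 1 = 1"
  shows "\<Delta> (\<phi> x) = \<Delta> x"
proof (rule real_polynomial_eq_of_regular[of "\<lambda>x. \<Delta> (\<phi> x)" \<Delta>])
  show "real_polynomial_function (\<lambda>x. \<Delta> (\<phi> x))"
    using lin by (intro jordan_det_compose_polynomial[OF \<Delta>] polynomial_function_bounded_linear)
      (simp add: linear_conv_bounded_linear)
  show "real_polynomial_function \<Delta>"
    using \<Delta> by (simp add: is_jordan_det_def)
  fix x :: 'a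
  assume x: "jordan_regular x"
  have pow: "\<phi> (x ^ n) = \<phi> x ^ n" for n
    by (induction n) (simp_all add: hom one)
  have ev: "jordan_eval p (\<phi> x) = \<phi> (jordan_eval p x)" for p
    using lin by (simp add: jordan_eval_def linear_sum linear_scale pow)
  have "jordan_eval p (\<phi> x) = 0 \<longleftrightarrow> jordan_eval p x = 0" for p
    using inj lin by (simp add: ev inj_eq linear_injective_0 linear_0 injD) (metis linear_0 injD)
  then have "jordan_degree (\<phi> x) = jordan_degree x" "jordan_minpoly (\<phi> x) = jordan_minpoly x"
    by (simp_all add: jordan_degree_def jordan_minpoly_def)
  then show "\<Delta> (\<phi> x) = \<Delta> x"
    using x \<Delta> by (simp add: is_jordan_det_def jordan_regular_def)
qed

section \<open>Inverses and nonvanishing of the determinant\<close>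

text \<open>The assumption \<open>g\<close> says that \<open>jordan_eval g x\<close> is an inverse
  of \<open>x\<close>, given as a polynomial in \<open>x\<close> so that associativity is available.
  Multiplying by \<open>x ^ n\<close> clears the negative powers.\<close>

lemma jordan_eval_inverse:
  fixes x :: "'a::{euclidean_space, real_jordan_algebra}"
  assumes g: "jordan_eval (pCons 0 g) x = 1" and n: "degree p \<le> n"
  shows "x ^ n * jordan_eval p (jordan_eval g x) = (\<Sum>i\<le>n. coeff p i *\<^sub>R x ^ (n - i))"
proof -
  let ?y = "jordan_eval g x"
  have "x ^ n * ?y ^ i = x ^ (n - i)" if "i \<le> n" for i
  proof -
    have "monom 1 n * g ^ i = monom 1 (n - i) * pCons 0 g ^ i"
    proof -
      have "pCons 0 g = monom 1 1 * g"
        by (simp add: monom_Suc monom_0 one_pCons)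
      then have "pCons 0 g ^ i = monom 1 i * g ^ i"
        by (simp add: power_mult_distrib monom_power)
      then show ?thesis
        using that by (simp add: mult_monom mult.assoc[symmetric])
    qed
    then have "jordan_eval (monom 1 n * g ^ i) x = jordan_eval (monom 1 (n - i) * pCons 0 g ^ i) x"
      by simp
    then show ?thesis
      by (simp only: jordan_eval_mult jordan_eval_power g jordan_eval_monom scaleR_one
          jordan_one_power jordan_unit_right)
  qed
  then show ?thesis
    by (simp add: jordan_eval_le[OF n] jordan_mult_sum jordan_scaleR_left)
qed

text \<open>With the minimal polynomial written as \<open>pCons c q\<close>, one has
  \<open>x * jordan_eval q x = - (c *\<^sub>R 1)\<close>, so \<open>q\<close> divided by
  \<open>- c\<close> gives the inverse.\<close>

lemma jordan_inverse_exists: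
  fixes x :: "'a::{euclidean_space, real_jordan_algebra}"
  assumes nz: "coeff (jordan_minpoly x) 0 \<noteq> 0"
  obtains g where "jordan_eval (pCons 0 g) x = 1"
proof -
  define c where "c = coeff (jordan_minpoly x) 0"
  obtain q where q: "jordan_minpoly x = pCons c q"
    by (metis c_def pCons_cases coeff_pCons_0)
  have "c *\<^sub>R 1 + x * jordan_eval q x = 0"
    using jordan_eval_minpoly[of x] jordan_eval_pCons[of c q x] q by simp
  then have "x * jordan_eval q x = - (c *\<^sub>R 1)"
    by (simp add: eq_neg_iff_add_eq_0 add.commute)
  moreover have "c \<noteq> 0"
    using nz by (simp add: c_def)
  ultimately have "jordan_eval (pCons 0 (smult (inverse (- c)) q)) x = 1"
    by (simp add: jordan_eval_pCons jordan_eval_smult jordan_scaleR_left del: inverse_minus_eq)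
      (simp add: scaleR_minus_left[symmetric] del: scaleR_minus_left)
  then show thesis by (rule that)
qed

text \<open>The minimal polynomial of the inverse is the reversed minimal polynomial of
  \<open>x\<close> divided by \<open>coeff p 0\<close>. Its own constant coefficient is therefore
  \<open>1 / coeff p 0\<close>, and the two signs cancel.\<close>

lemma jordan_det_inverse:
  fixes x :: "'a::{euclidean_space, simple_real_jordan_algebra}"
  assumes \<Delta>: "is_jordan_det \<Delta>" and x: "jordan_regular x" and nz: "\<Delta> x \<noteq> 0"
  obtains g where "jordan_eval (pCons 0 g) x = 1" "\<Delta> x * \<Delta> (jordan_eval g x) = 1"
proof -
  define r where "r = jordan_rank (UNIV :: 'a set)"
  define p where "p = jordan_minpoly x"
  have dp: "degree p = r" and deg: "jordan_degree x = r"
    using x by (simp_all add: p_def r_def degree_jordan_minpoly jordan_regular_def)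
  have p0: "\<Delta> x = (- 1) ^ r * coeff p 0"
    using \<Delta> x by (simp add: is_jordan_det_def p_def r_def)
  then have nz0: "coeff p 0 \<noteq> 0"
    using nz by auto
  then obtain g where g: "jordan_eval (pCons 0 g) x = 1"
    using jordan_inverse_exists[of x] by (auto simp: p_def)
  define y where "y = jordan_eval g x"
  \<comment> \<open>Reversing a nonzero annihilator of \<open>y\<close> gives one of
    \<open>x\<close>, so none of them has degree below \<open>r\<close>.\<close>
  have le: "r \<le> degree f" if f: "f \<noteq> 0" "jordan_eval f y = 0" for f
  proof -
    have "(\<Sum>i\<le>degree f. coeff f i *\<^sub>R x ^ (degree f - i)) = 0"
      using jordan_eval_inverse[OF g, of f "degree f"] f by (simp add: y_def jordan_zero_right)
    also have "(\<Sum>i\<le>degree f. coeff f i *\<^sub>R x ^ (degree f - i)) =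
        (\<Sum>i\<le>degree f. coeff f (degree f - i) *\<^sub>R x ^ i)"
      by (rule sum.reindex_bij_witness[of _ "\<lambda>i. degree f - i" "\<lambda>i. degree f - i"]) auto
    also have "\<dots> = jordan_eval (reflect_poly f) x"
      by (subst jordan_eval_le[OF degree_reflect_poly_le]) (simp add: coeff_reflect_poly)
    finally have "jordan_degree x \<le> degree (reflect_poly f)"
      using f by (intro jordan_degree_le) auto
    then show ?thesis
      using degree_reflect_poly_le[of f] by (simp add: deg)
  qed
  have ann: "jordan_eval (reflect_poly p) y = 0"
  proof -
    have "x ^ r * jordan_eval (reflect_poly p) y = (\<Sum>i\<le>r. coeff p (r - i) *\<^sub>R x ^ (r - i))"
      using jordan_eval_inverse[OF g, of "reflect_poly p" r] nz0 dp
      by (simp add: y_def coeff_reflect_poly)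
    also have "\<dots> = (\<Sum>i\<le>r. coeff p i *\<^sub>R x ^ i)"
      by (rule sum.reindex_bij_witness[of _ "\<lambda>i. r - i" "\<lambda>i. r - i"]) auto
    also have "\<dots> = 0"
      using jordan_eval_minpoly[of x] dp by (simp add: jordan_eval_def p_def[symmetric])
    finally have 0: "jordan_eval (monom 1 r * pcompose (reflect_poly p) g) x = 0"
      by (simp add: jordan_eval_mult jordan_eval_monom jordan_eval_pcompose y_def)
    have "pCons 0 g ^ r = g ^ r * monom 1 r"
    proof -
      have "pCons 0 g = g * monom 1 1"
        by (simp add: monom_Suc monom_0 one_pCons mult.commute[of g])
      then show ?thesis
        by (simp add: power_mult_distrib monom_power)
    qed
    then have "jordan_eval (g ^ r * (monom 1 r * pcompose (reflect_poly p) g)) x =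
        jordan_eval (pCons 0 g ^ r * pcompose (reflect_poly p) g) x"
      by (simp add: mult.assoc)
    also have "\<dots> = jordan_eval (reflect_poly p) y"
      by (simp only: jordan_eval_mult jordan_eval_power g jordan_one_power jordan_unit
          jordan_eval_pcompose y_def)
    finally show ?thesis
      using 0 by (simp add: jordan_eval_mult jordan_zero_right)
  qed
  have degy: "jordan_degree y = r"
  proof (rule antisym)
    have "jordan_degree y \<le> degree (reflect_poly p)"
      using ann nz0 by (intro jordan_degree_le) auto
    then show "jordan_degree y \<le> r"
      using nz0 dp by simp
    have "jordan_minpoly y \<noteq> 0"
      using lead_coeff_jordan_minpoly[of y] by auto
    then show "r \<le> jordan_degree y"
      using le[of "jordan_minpoly y"] by (simp add: jordan_eval_minpoly degree_jordan_minpoly)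
  qed
  have "jordan_minpoly y = smult (1 / coeff p 0) (reflect_poly p)"
    using nz0 dp degy ann
    by (intro jordan_minpoly_eqI) (simp_all add: jordan_eval_smult coeff_reflect_poly)
  moreover have "coeff (reflect_poly p) 0 = 1"
    using lead_coeff_jordan_minpoly[of x] by (simp add: p_def)
  ultimately have "coeff (jordan_minpoly y) 0 = 1 / coeff p 0"
    by simp
  moreover have "jordan_regular y"
    using degy by (simp add: jordan_regular_def r_def)
  ultimately have "\<Delta> y = (- 1) ^ r * (1 / coeff p 0)"
    using \<Delta> by (simp add: is_jordan_det_def r_def)
  then have "\<Delta> x * \<Delta> y = 1"
    using p0 nz0 by (simp add: power_mult_distrib[symmetric])
  then show thesis
    using that g by (simp add: y_def)
qed

text \<open>The inverses of regular elements close to \<open>z\<close> stay bounded, so their determinants do too, and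
  \<open>\<Delta>\<close> is bounded away from 0 near \<open>z\<close>.\<close>

lemma jordan_det_nonzero:
  fixes z :: "'a::{euclidean_space, simple_real_jordan_algebra}"
  assumes \<Delta>: "is_jordan_det \<Delta>" and g: "jordan_eval (pCons 0 g) z = 1"
  shows "\<Delta> z \<noteq> 0"
proof -
  interpret mult: bounded_bilinear "(*) :: 'a \<Rightarrow> 'a \<Rightarrow> 'a"
    by (rule bounded_bilinear_jordan_mult)
  obtain C where C: "C > 0" "\<And>a b :: 'a. norm (a * b) \<le> norm a * norm b * C"
    using mult.pos_bounded by blast
  have cont: "continuous_on UNIV (\<lambda>x :: 'a. jordan_eval f x)" for f
    by (intro continuous_on_polymonial_function polynomial_function_jordan_eval polynomial_function_id)
  \<comment> \<open>The factor 2 comes from absorbing \<open>(1 / 2) * norm ?y\<close> in the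
    estimate of the inverse below.\<close>
  define M where "M = 2 * (norm (jordan_eval g z) + 1)"
  have "compact (\<Delta> ` cball 0 M)"
    by (intro compact_continuous_image is_jordan_det_continuous[OF \<Delta>] compact_cball)
  then obtain B where "\<forall>t\<in>\<Delta> ` cball 0 M. norm t \<le> B"
    using compact_imp_bounded bounded_iff by blast
  then have B: "\<bar>\<Delta> y\<bar> \<le> B" if "norm y \<le> M" for y
    using that by auto
  \<comment> \<open>Near \<open>z\<close> the fixed polynomial \<open>g\<close> still provides an
    approximate inverse \<open>jordan_eval g x\<close> of \<open>x\<close>, of bounded norm.\<close>
  define U where "U = {x :: 'a. norm (1 - jordan_eval (pCons 0 g) x) * C < 1 / 2} \<inter>
    {x. norm (jordan_eval g x) < norm (jordan_eval g z) + 1}"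
  have "open U"
    unfolding U_def by (intro open_Int open_Collect_less continuous_intros) (rule cont)+
  have "z \<in> U"
    using g by (simp add: U_def)
  have bound: "1 \<le> \<bar>\<Delta> x\<bar> * B" if x: "x \<in> U" "jordan_regular x" "\<Delta> x \<noteq> 0" for x
  proof -
    obtain h where h: "jordan_eval (pCons 0 h) x = 1" "\<Delta> x * \<Delta> (jordan_eval h x) = 1"
      by (rule jordan_det_inverse[OF \<Delta> x(2,3)])
    let ?y = "jordan_eval h x"
    have "pCons 0 g * h = g * pCons 0 h"
      by simp
    then have "jordan_eval (pCons 0 g) x * ?y = jordan_eval g x"
      by (metis jordan_eval_mult h(1) jordan_unit_right)
    \<comment> \<open>The exact inverse is the approximate one plus a correction of norm at most
      half of \<open>norm ?y\<close>.\<close>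
    then have "?y = jordan_eval g x + (1 - jordan_eval (pCons 0 g) x) * ?y"
      by (simp add: jordan_diff jordan_unit)
    then have "norm ?y \<le> norm (jordan_eval g x) + norm ((1 - jordan_eval (pCons 0 g) x) * ?y)"
      by (metis norm_triangle_ineq)
    also have "norm ((1 - jordan_eval (pCons 0 g) x) * ?y) \<le>
        (norm (1 - jordan_eval (pCons 0 g) x) * C) * norm ?y"
      using C(2)[of "1 - jordan_eval (pCons 0 g) x" ?y] by (simp add: mult.commute mult.left_commute)
    also have "\<dots> \<le> (1 / 2) * norm ?y"
      using x(1) by (intro mult_right_mono) (auto simp: U_def)
    finally have "norm ?y \<le> 2 * norm (jordan_eval g x)"
      by simp
    also have "\<dots> \<le> M"
      using x(1) by (simp add: U_def M_def)
    finally have "\<bar>\<Delta> ?y\<bar> \<le> B"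
      by (rule B)
    have "1 = \<bar>\<Delta> x\<bar> * \<bar>\<Delta> ?y\<bar>"
      using h(2) by (simp add: abs_mult[symmetric])
    also have "\<dots> \<le> \<bar>\<Delta> x\<bar> * B"
      using \<open>\<bar>\<Delta> ?y\<bar> \<le> B\<close> by (intro mult_left_mono) auto
    finally show ?thesis .
  qed
  have "real_polynomial_function \<Delta>"
    using \<Delta> by (simp add: is_jordan_det_def)
  then have dense: "closure {x. jordan_regular x \<and> \<Delta> x \<noteq> 0} = UNIV"
    using jordan_det_one[OF \<Delta>] by (intro closure_jordan_regular_nonzero[of _ 1]) auto
  show ?thesis
  proof
    assume "\<Delta> z = 0"
    define W where "W = U \<inter> {x. \<bar>\<Delta> x\<bar> * B < 1}"
    have "open W"
      unfolding W_def using \<open>open U\<close>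
      by (intro open_Int open_Collect_less continuous_intros is_jordan_det_continuous[OF \<Delta>])
    moreover have "z \<in> W"
      using \<open>z \<in> U\<close> \<open>\<Delta> z = 0\<close> by (simp add: W_def)
    ultimately obtain x where "x \<in> W" "jordan_regular x" "\<Delta> x \<noteq> 0"
      using dense open_Int_closure_eq_empty[of W "{x. jordan_regular x \<and> \<Delta> x \<noteq> 0}"] by blast
    then show False
      using bound[of x] by (simp add: W_def)
  qed
qed

section \<open>Positivity of the determinant on the symmetric cone\<close>

context
  fixes \<alpha> :: "'a::{euclidean_space, simple_real_jordan_algebra} \<Rightarrow> 'a"
  assumes \<alpha>: "euclidean_involution \<alpha>"
begin

lemma euclidean_involution_linear: "linear \<alpha>"
  and euclidean_involution_mult: "\<alpha> (x * y) = \<alpha> x * \<alpha> y"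
  and euclidean_involution_involutive: "\<alpha> (\<alpha> x) = x"
  and euclidean_involution_pos: "x \<noteq> 0 \<Longrightarrow> 0 < operator_trace (\<lambda>z. (\<alpha> x * x) * z)"
  using \<alpha> by (auto simp: euclidean_involution_def)

lemma euclidean_involution_one: "\<alpha> 1 = 1"
proof -
  have "\<alpha> 1 = \<alpha> (1 * \<alpha> 1)"
    by (simp only: euclidean_involution_mult euclidean_involution_involutive jordan_unit_right)
  then show ?thesis
    by (simp add: jordan_unit euclidean_involution_involutive)
qed

lemma V0_mult: "x \<in> V0 \<alpha> \<Longrightarrow> y \<in> V0 \<alpha> \<Longrightarrow> x * y \<in> V0 \<alpha>"
  by (simp add: V0_def euclidean_involution_mult)

lemma V0_one: "1 \<in> V0 \<alpha>"
  by (simp add: V0_def euclidean_involution_one)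

lemma V0_add: "x \<in> V0 \<alpha> \<Longrightarrow> y \<in> V0 \<alpha> \<Longrightarrow> x + y \<in> V0 \<alpha>"
  by (simp add: V0_def linear_add[OF euclidean_involution_linear])

lemma V0_scaleR: "x \<in> V0 \<alpha> \<Longrightarrow> c *\<^sub>R x \<in> V0 \<alpha>"
  by (simp add: V0_def linear_scale[OF euclidean_involution_linear])

lemma V0_jordan_eval: "x \<in> V0 \<alpha> \<Longrightarrow> jordan_eval p x \<in> V0 \<alpha>"
proof (induction p rule: pCons_induct)
  case 0
  then show ?case
    by (simp add: V0_def linear_0[OF euclidean_involution_linear])
next
  case (pCons a p)
  then show ?case
    by (simp add: jordan_eval_pCons V0_add V0_scaleR V0_one V0_mult)
qed

text \<open>On \<open>V0\<close> the positivity in \<open>euclidean_involution\<close> says that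
  multiplication by \<open>w * w\<close> has positive trace for \<open>w \<noteq> 0\<close>. The
  trace of the relation would then be positive if \<open>x \<noteq> 0\<close>.\<close>

lemma V0_formally_real:
  assumes x: "x \<in> V0 \<alpha>" and y: "y \<in> V0 \<alpha>" and c: "0 < c" and 0: "c *\<^sub>R (x * x) + y * y = 0"
  shows "x = 0"
proof (rule ccontr)
  define \<tau> where "\<tau> = (\<lambda>a :: 'a. operator_trace ((*) a))"
  have pos: "\<tau> (w * w) > 0" if "w \<noteq> 0" "w \<in> V0 \<alpha>" for w
    using euclidean_involution_pos[of w] that by (simp add: \<tau>_def V0_def)
  have "\<tau> 0 = 0"
    by (simp add: \<tau>_def operator_trace_def jordan_zero)
  with pos have nonneg: "\<tau> (y * y) \<ge> 0"
    using y by (cases "y = 0") (auto simp: jordan_zero intro: less_imp_le)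
  assume "x \<noteq> 0"
  have "\<tau> (c *\<^sub>R (x * x) + y * y) = c * \<tau> (x * x) + \<tau> (y * y)"
    by (simp add: \<tau>_def operator_trace_def jordan_distrib jordan_scaleR inner_add_left
        sum.distrib sum_distrib_left)
  moreover have "c * \<tau> (x * x) > 0"
    using c pos x \<open>x \<noteq> 0\<close> by simp
  ultimately show False
    using 0 \<open>\<tau> 0 = 0\<close> nonneg by simp
qed

text \<open>If 0 were a root of the minimal polynomial of \<open>c *\<^sub>R 1 + b * b\<close>, this
  element would annihilate some nonzero \<open>w\<close> generated by \<open>b\<close>. Multiplying
  by \<open>w\<close> gives \<open>c *\<^sub>R (w * w) + (b * w) * (b * w) = 0\<close>, contrary to
  formal reality.\<close>

lemma jordan_det_unit_plus_square_nonzero: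
  assumes \<Delta>: "is_jordan_det \<Delta>" and b: "b \<in> V0 \<alpha>" and c: "0 < c"
  shows "\<Delta> (c *\<^sub>R 1 + b * b) \<noteq> 0"
proof -
  let ?z = "c *\<^sub>R 1 + b * b" and ?h = "[:c, 0, 1:]"
  have z: "jordan_eval ?h b = ?z"
    by (simp add: jordan_eval_pCons jordan_zero_right jordan_unit_right)
  have "coeff (jordan_minpoly ?z) 0 \<noteq> 0"
  proof
    assume c0: "coeff (jordan_minpoly ?z) 0 = 0"
    obtain q where q: "jordan_minpoly ?z = pCons 0 q"
      by (metis c0 pCons_cases coeff_pCons_0)
    have "q \<noteq> 0"
      using q lead_coeff_jordan_minpoly[of ?z] by auto
    define f where "f = pcompose q ?h"
    define w where "w = jordan_eval f b"
    have w: "w = jordan_eval q ?z"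
      by (simp add: w_def f_def jordan_eval_pcompose z)
    have "w \<noteq> 0"
    proof
      assume "w = 0"
      then have "jordan_degree ?z \<le> degree q"
        using \<open>q \<noteq> 0\<close> w by (intro jordan_degree_le) auto
      then show False
        using degree_jordan_minpoly[of ?z] q \<open>q \<noteq> 0\<close> by simp
    qed
    have "jordan_eval (?h * f) b = 0"
      using jordan_eval_minpoly[of ?z] jordan_eval_pCons[of 0 q ?z] q w
      by (simp add: jordan_eval_mult z w_def[symmetric] del: mult_pCons_left)
    then have "jordan_eval (?h * f * f) b = 0"
      by (simp add: jordan_eval_mult jordan_zero del: mult_pCons_left)
    moreover have "?h * f * f = smult c (f * f) + pCons 0 f * pCons 0 f"
      by (simp add: algebra_simps)
    ultimately have "c *\<^sub>R (w * w) + (b * w) * (b * w) = 0"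
      by (simp add: jordan_eval_add jordan_eval_smult jordan_eval_mult jordan_eval_pCons
          w_def del: mult_pCons_left mult_pCons_right)
    moreover have "w \<in> V0 \<alpha>"
      unfolding w_def using b by (rule V0_jordan_eval)
    ultimately show False
      using V0_formally_real[of w "b * w" c] V0_mult b c \<open>w \<noteq> 0\<close> by blast
  qed
  then obtain g where "jordan_eval (pCons 0 g) ?z = 1"
    by (rule jordan_inverse_exists)
  then show ?thesis
    by (rule jordan_det_nonzero[OF \<Delta>])
qed

text \<open>An interior point remains a square after subtraction of a small positive multiple of the
  unit.\<close>

lemma Omega0_E:
  assumes "u \<in> Omega0 \<alpha>"
  obtains c b where "0 < c" "b \<in> V0 \<alpha>" "u = c *\<^sub>R 1 + b * b"
proof -
  obtain T where T: "openin (top_of_set (V0 \<alpha>)) T" "u \<in> T" "T \<subseteq> {x * x |x. x \<in> V0 \<alpha>}"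
    using assms by (auto simp: Omega0_def interior_of_def)
  then obtain T' where T': "open T'" "T = V0 \<alpha> \<inter> T'"
    by (auto simp: openin_open)
  have "open ((\<lambda>t. u - t *\<^sub>R 1) -` T')"
    by (intro open_vimage T' continuous_intros)
  moreover have "0 \<in> (\<lambda>t. u - t *\<^sub>R 1) -` T'"
    using T(2) T'(2) by simp
  ultimately obtain e where e: "e > 0" "\<And>t. dist t 0 < e \<Longrightarrow> t \<in> (\<lambda>t. u - t *\<^sub>R 1) -` T'"
    unfolding open_dist by blast
  have "u \<in> V0 \<alpha>"
    using T(2) T'(2) by simp
  then have "u - (e / 2) *\<^sub>R 1 \<in> V0 \<alpha>"
    using V0_add[of u "(- (e / 2)) *\<^sub>R 1"] V0_scaleR[OF V0_one, of "- (e / 2)"] by simp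
  moreover have "u - (e / 2) *\<^sub>R 1 \<in> T'"
    using e(2)[of "e / 2"] e(1) by (simp add: dist_norm)
  ultimately have "u - (e / 2) *\<^sub>R 1 \<in> {x * x |x. x \<in> V0 \<alpha>}"
    using T(3) T'(2) by blast
  then obtain b where "b \<in> V0 \<alpha>" "u - (e / 2) *\<^sub>R 1 = b * b"
    by blast
  then show thesis
    using e(1) by (intro that[of "e / 2" b]) (auto simp: algebra_simps)
qed

lemma jordan_det_Omega0_pos:
  assumes \<Delta>: "is_jordan_det \<Delta>" and u: "u \<in> Omega0 \<alpha>"
  shows "0 < \<Delta> u"
proof (rule ccontr)
  assume neg: "\<not> 0 < \<Delta> u"
  obtain c b where cb: "0 < c" "b \<in> V0 \<alpha>" "u = c *\<^sub>R 1 + b * b"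
    using u by (rule Omega0_E)
  define \<phi> where "\<phi> = (\<lambda>t::real. \<Delta> (c *\<^sub>R 1 + t *\<^sub>R (b * b)))"
  have "\<phi> 0 = c ^ jordan_rank (UNIV :: 'a set)"
    using cb(1) by (simp add: \<phi>_def jordan_det_scaleR[OF \<Delta>] jordan_det_one[OF \<Delta>])
  then have "\<phi> 0 \<ge> 0"
    using cb(1) by simp
  moreover have "\<phi> 1 \<le> 0"
    using neg cb(3) by (simp add: \<phi>_def)
  moreover have "continuous_on {0..1} \<phi>"
    unfolding \<phi>_def
    by (intro continuous_on_compose2[OF is_jordan_det_continuous[OF \<Delta>, of UNIV]] continuous_intros)
      auto
  ultimately obtain t where t: "0 \<le> t" "\<phi> t = 0"
    using IVT2'[of \<phi> 1 0 0] by auto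
  \<comment> \<open>Absorbing \<open>t\<close> into \<open>b\<close> through its square root keeps
    the element in the form already shown to have nonzero determinant.\<close>
  have "t *\<^sub>R (b * b) = (sqrt t *\<^sub>R b) * (sqrt t *\<^sub>R b)"
    using t by (simp add: jordan_scaleR jordan_scaleR_left)
  then have "\<phi> t \<noteq> 0"
    using jordan_det_unit_plus_square_nonzero[OF \<Delta> V0_scaleR[OF cb(2), of "sqrt t"] cb(1)]
    by (simp add: \<phi>_def)
  then show False
    using t by simp
qed

section \<open>The Makarevich space\<close>

text \<open>In this form the space is a preimage under the projection to \<open>V0\<close>, from
  which openness and positivity of \<open>\<Delta>\<close> are read off.\<close>

lemma makarevich_space_iff: "x \<in> makarevich_space \<alpha> \<longleftrightarrow> V0_part \<alpha> x \<in> Omega0 \<alpha>"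
proof
  assume "x \<in> makarevich_space \<alpha>"
  then obtain u v where uv: "x = u + v" "u \<in> Omega0 \<alpha>" "v \<in> V1 \<alpha>"
    by (auto simp: makarevich_space_def)
  have "u \<in> topspace (top_of_set (V0 \<alpha>))"
    using uv(2) interior_of_subset_topspace[of "top_of_set (V0 \<alpha>)"] unfolding Omega0_def
    by (rule rev_subsetD)
  then have "\<alpha> u = u"
    by (simp add: V0_def)
  moreover have "\<alpha> v = - v"
    using uv(3) by (simp add: V1_def)
  ultimately have "V0_part \<alpha> x = u"
    using uv(1) by (simp add: V0_part_def linear_add[OF euclidean_involution_linear] scaleR_2[symmetric])
  then show "V0_part \<alpha> x \<in> Omega0 \<alpha>"
    using uv(2) by simp
next
  assume *: "V0_part \<alpha> x \<in> Omega0 \<alpha>"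
  have "x - V0_part \<alpha> x \<in> V1 \<alpha>"
    by (simp add: V1_def V0_part_def linear_diff[OF euclidean_involution_linear]
        linear_scale[OF euclidean_involution_linear] linear_add[OF euclidean_involution_linear]
        euclidean_involution_involutive) (simp add: algebra_simps scaleR_add_left[symmetric])
  moreover have "x = V0_part \<alpha> x + (x - V0_part \<alpha> x)"
    by simp
  ultimately show "x \<in> makarevich_space \<alpha>"
    unfolding makarevich_space_def using * by blast
qed

lemma continuous_on_V0_part: "continuous_on S (V0_part \<alpha>)"
proof -
  have "continuous_on S \<alpha>"
    using euclidean_involution_linear by (simp add: linear_continuous_on linear_conv_bounded_linear)
  then show ?thesis
    unfolding V0_part_def by (intro continuous_intros)
qed

lemma open_makarevich_space: "open (makarevich_space \<alpha>)"
proof -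
  have "openin (top_of_set (V0 \<alpha>)) (Omega0 \<alpha>)"
    unfolding Omega0_def by (rule openin_interior_of)
  then obtain T where T: "open T" "Omega0 \<alpha> = V0 \<alpha> \<inter> T"
    by (auto simp: openin_open)
  have "V0_part \<alpha> x \<in> V0 \<alpha>" for x
    by (simp add: V0_def V0_part_def linear_scale[OF euclidean_involution_linear]
        linear_add[OF euclidean_involution_linear] euclidean_involution_involutive add.commute)
  then have "makarevich_space \<alpha> = V0_part \<alpha> -` T"
    by (auto simp: makarevich_space_iff T(2))
  then show ?thesis
    by (simp add: open_vimage[OF T(1)] continuous_on_V0_part)
qed

lemma jordan_det_makarevich_pos:
  "is_jordan_det \<Delta> \<Longrightarrow> x \<in> makarevich_space \<alpha> \<Longrightarrow> 0 < \<Delta> (V0_part \<alpha> x)"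
  by (simp add: makarevich_space_iff jordan_det_Omega0_pos)

lemma jordan_det_involution: "is_jordan_det \<Delta> \<Longrightarrow> \<Delta> (\<alpha> x) = \<Delta> x"
  by (rule jordan_det_automorphism)
    (auto simp: euclidean_involution_linear euclidean_involution_mult euclidean_involution_one
      intro: inj_on_inverseI[of _ \<alpha>] euclidean_involution_involutive)

end

section \<open>Invariance of Lebesgue measure under linear involutions\<close>

text \<open>Uniqueness of translation-invariant measures by Fubini's theorem, applied to the integral of
  \<open>1\<^sub>A(x) 1\<^sub>B(x + f y)\<close>. The factor of proportionality is read off an invariant neighbourhood of 0.\<close>

lemma lborel_distr_linear_involution:
  fixes f :: "'a::euclidean_space \<Rightarrow> 'a"
  assumes lin: "linear f" and inv: "\<And>x. f (f x) = x"
  shows "distr lborel borel f = lborel"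
proof -
  have cont: "continuous_on S f" for S
    using lin by (simp add: linear_continuous_on linear_conv_bounded_linear)
  have [measurable]: "f \<in> borel_measurable borel"
    by (rule borel_measurable_continuous_onI[OF cont])
  define \<nu> where "\<nu> = (\<lambda>A. emeasure lborel (f -` A))"
  have f_add: "f (x + y) = f x + f y" and f_diff: "f (x - y) = f x - f y" for x y
    using lin by (simp_all add: linear_add linear_diff)
  have \<nu>_eq: "\<nu> A = (\<integral>\<^sup>+y. indicator A (f y) \<partial>lborel)" if [measurable]: "A \<in> sets borel" for A
  proof -
    have "f -` A \<in> sets borel"
      using measurable_sets[of f borel borel A] that by simp
    then have "\<nu> A = (\<integral>\<^sup>+y. indicator (f -` A) y \<partial>lborel)"
      unfolding \<nu>_def by simp
    then show ?thesis
      by (simp add: indicator_def)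
  qed
  have translate: "(\<integral>\<^sup>+y. h (c + y) \<partial>lborel) = (\<integral>\<^sup>+y. h y \<partial>lborel)"
    if [measurable]: "h \<in> borel_measurable borel" for h :: "'a \<Rightarrow> ennreal" and c
    by (subst (2) lborel_distr_plus[of c, symmetric], subst nn_integral_distr) auto
  have reflect: "(\<integral>\<^sup>+y. h (c - y) \<partial>lborel) = (\<integral>\<^sup>+y. h y \<partial>lborel)"
    if [measurable]: "h \<in> borel_measurable borel" for h :: "'a \<Rightarrow> ennreal" and c
    by (subst (2) lborel_affine[of "-1" c], simp, subst nn_integral_density)
      (auto simp: nn_integral_distr)
  have key: "emeasure lborel A * \<nu> B = emeasure lborel B * \<nu> A"
    if [measurable]: "A \<in> sets borel" "B \<in> sets borel" for A B
  proof -
    have "(\<integral>\<^sup>+x. \<integral>\<^sup>+y. indicator A x * indicator B (x + f y) \<partial>lborel \<partial>lborel) =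
        (\<integral>\<^sup>+x. indicator A x * \<nu> B \<partial>lborel)"
    proof (rule nn_integral_cong)
      fix x :: 'a
      \<comment> \<open>Since \<open>x = f (f x)\<close>, the argument is an image under
        \<open>f\<close>, and translation invariance removes \<open>x\<close>.\<close>
      have "(\<integral>\<^sup>+y. indicator B (x + f y) \<partial>lborel) = (\<integral>\<^sup>+y. indicator B (f (f x + y)) \<partial>lborel)"
        by (simp add: f_add inv)
      also have "\<dots> = \<nu> B"
        by (subst translate[of "\<lambda>y. indicator B (f y)"]) (simp_all add: \<nu>_eq)
      finally show "(\<integral>\<^sup>+y. indicator A x * indicator B (x + f y) \<partial>lborel) = indicator A x * \<nu> B"
        by (simp add: nn_integral_cmult)
    qed
    also have "\<dots> = emeasure lborel A * \<nu> B"
      by (simp add: nn_integral_multc)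
    finally have 1: "(\<integral>\<^sup>+x. \<integral>\<^sup>+y. indicator A x * indicator B (x + f y) \<partial>lborel \<partial>lborel) =
        emeasure lborel A * \<nu> B" .
    have "(\<integral>\<^sup>+x. \<integral>\<^sup>+y. indicator A x * indicator B (x + f y) \<partial>lborel \<partial>lborel) =
        (\<integral>\<^sup>+y. \<integral>\<^sup>+x. indicator A x * indicator B (x + f y) \<partial>lborel \<partial>lborel)"
      by (rule lborel_pair.Fubini'[symmetric]) measurable
    also have "\<dots> = (\<integral>\<^sup>+y. \<integral>\<^sup>+x. indicator A (x - f y) * indicator B x \<partial>lborel \<partial>lborel)"
    proof (rule nn_integral_cong)
      fix y :: 'a
      show "(\<integral>\<^sup>+x. indicator A x * indicator B (x + f y) \<partial>lborel) =
          (\<integral>\<^sup>+x. indicator A (x - f y) * indicator B x \<partial>lborel)"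
        using translate[of "\<lambda>x. indicator A (x - f y) * indicator B x" "f y"]
        by (simp add: add.commute)
    qed
    also have "\<dots> = (\<integral>\<^sup>+x. \<integral>\<^sup>+y. indicator A (x - f y) * indicator B x \<partial>lborel \<partial>lborel)"
      by (rule lborel_pair.Fubini'[symmetric]) measurable
    also have "\<dots> = (\<integral>\<^sup>+x. \<nu> A * indicator B x \<partial>lborel)"
    proof (rule nn_integral_cong)
      fix x :: 'a
      have "(\<integral>\<^sup>+y. indicator A (x - f y) \<partial>lborel) = (\<integral>\<^sup>+y. indicator A (f (f x - y)) \<partial>lborel)"
        by (simp add: f_diff inv)
      also have "\<dots> = \<nu> A"
        by (subst reflect[of "\<lambda>y. indicator A (f y)"]) (simp_all add: \<nu>_eq)
      finally show "(\<integral>\<^sup>+y. indicator A (x - f y) * indicator B x \<partial>lborel) = \<nu> A * indicator B x"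
        by (simp add: nn_integral_multc)
    qed
    also have "\<dots> = \<nu> A * emeasure lborel B"
      by (simp add: nn_integral_cmult)
    finally show ?thesis
      using 1 by (simp add: mult.commute)
  qed
  \<comment> \<open>A bounded neighbourhood of 0 invariant under \<open>f\<close>: its measure is
    positive and finite and equals \<open>\<nu> S\<close>, so it can be cancelled.\<close>
  define S where "S = ball 0 1 \<inter> f -` ball 0 1"
  have "open S"
    unfolding S_def by (intro open_Int open_ball open_vimage cont)
  have "0 \<in> S"
    using lin by (simp add: S_def linear_0)
  then obtain e where e: "e > 0" "ball 0 e \<subseteq> S"
    using \<open>open S\<close> open_contains_ball by blast
  have "0 < emeasure lborel (ball (0::'a) e)"
    using content_ball_pos[OF e(1), of "0 :: 'a"]
    by (auto simp: zero_less_iff_neq_zero measure_def)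
  also have "\<dots> \<le> emeasure lborel S"
    using e(2) \<open>open S\<close> by (intro emeasure_mono) auto
  finally have pos: "emeasure lborel S \<noteq> 0"
    by auto
  have "emeasure lborel S \<le> emeasure lborel (ball (0::'a) 1)"
    by (intro emeasure_mono) (auto simp: S_def)
  also have "\<dots> < \<infinity>"
    by (rule emeasure_lborel_ball_finite)
  finally have fin: "emeasure lborel S \<noteq> top"
    by auto
  have "f -` S = S"
    by (auto simp: S_def inv)
  then have "\<nu> S = emeasure lborel S"
    by (simp add: \<nu>_def)
  show ?thesis
  proof (rule measure_eqI)
    fix A assume "A \<in> sets (distr lborel borel f)"
    then have A: "A \<in> sets borel"
      by simp
    have "emeasure lborel S * emeasure lborel A = emeasure lborel S * \<nu> A"
      using key[OF A, of S] \<open>open S\<close> \<open>\<nu> S = _\<close> by (simp add: mult.commute)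
    then have "\<nu> A = emeasure lborel A"
      using pos fin by (simp add: ennreal_mult_cancel_left)
    then show "emeasure (distr lborel borel f) A = emeasure lborel A"
      using A by (simp add: emeasure_distr \<nu>_def)
  qed simp
qed

section \<open>The Berezin form\<close>

lemma of_real_powr_pos:
  "0 < a \<Longrightarrow> complex_of_real a powr c = exp (c * complex_of_real (ln a))"
  by (simp add: powr_def Ln_of_real)

text \<open>Off the space the determinants may have any sign, and the complex logarithm jumps at the
  negative axis; splitting it into \<open>ln \<bar>t\<bar>\<close> and a piecewise constant
  imaginary part keeps measurability.\<close>

lemma borel_measurable_of_real_powr [measurable]:
  assumes [measurable]: "h \<in> borel_measurable M"
  shows "(\<lambda>x. complex_of_real (h x) powr c) \<in> borel_measurable M"
proof -
  have [measurable]: "(exp :: complex \<Rightarrow> complex) \<in> borel_measurable borel"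
    by (intro borel_measurable_continuous_onI continuous_intros)
  have eq: "complex_of_real t powr c = (if t = 0 then 0 else
      exp (c * (complex_of_real (ln \<bar>t\<bar>) + (if t < 0 then pi else 0) * \<i>)))" for t
    by (cases "t = 0") (simp_all only: powr_def Ln_of_real' of_real_eq_0_iff if_True if_False
        of_real_0 simp_thms)
  show ?thesis
    unfolding eq by measurable
qed

lemma borel_measurable_Cc:
  assumes "f \<in> Cc X" "open X"
  shows "f \<in> borel_measurable borel"
proof -
  have "(\<lambda>x. indicator X x *\<^sub>R f x) \<in> borel_measurable borel"
    using assms by (intro borel_measurable_continuous_on_indicator) (auto simp: Cc_def)
  moreover have "(\<lambda>x. indicator X x *\<^sub>R f x) = f"
    using assms by (auto simp: Cc_def indicator_def fun_eq_iff)
  ultimately show ?thesis by simp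
qed

context
  fixes \<alpha> :: "'a::{euclidean_space, simple_real_jordan_algebra} \<Rightarrow> 'a" and \<Delta> :: "'a \<Rightarrow> real"
  assumes \<alpha>: "euclidean_involution \<alpha>" and \<Delta>: "is_jordan_det \<Delta>"
begin

section \<open>The operator \<open>M_op\<close> on compactly supported functions\<close>

lemma continuous_on_det_V0_part: "continuous_on S (\<lambda>x. \<Delta> (V0_part \<alpha> x))"
  by (rule continuous_on_compose2[OF is_jordan_det_continuous[OF \<Delta>, of UNIV]
        continuous_on_V0_part[OF \<alpha>]]) simp

lemma det_V0_part_powr_mult_Cc:
  assumes f: "f \<in> Cc (makarevich_space \<alpha>)"
  shows "(\<lambda>x. complex_of_real (\<Delta> (V0_part \<alpha> x)) powr c * f x) \<in> Cc (makarevich_space \<alpha>)"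
proof -
  let ?X = "makarevich_space \<alpha>"
  have nz: "\<Delta> (V0_part \<alpha> x) > 0" if "x \<in> ?X" for x
    using jordan_det_makarevich_pos[OF \<alpha> \<Delta> that] .
  have "continuous_on ?X (\<lambda>x. exp (c * complex_of_real (ln (\<Delta> (V0_part \<alpha> x)))))"
    using nz by (intro continuous_intros continuous_on_det_V0_part) force
  then have "continuous_on ?X (\<lambda>x. complex_of_real (\<Delta> (V0_part \<alpha> x)) powr c)"
    by (rule continuous_on_eq) (simp add: of_real_powr_pos nz)
  then have "continuous_on ?X (\<lambda>x. complex_of_real (\<Delta> (V0_part \<alpha> x)) powr c * f x)"
    using f by (intro continuous_on_mult) (auto simp: Cc_def)
  then show ?thesis
    using f by (auto simp: Cc_def)
qed

lemma det_V0_part_powr_cancel: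
  assumes f: "f \<in> Cc (makarevich_space \<alpha>)"
  shows "complex_of_real (\<Delta> (V0_part \<alpha> x)) powr (- e) *
    (complex_of_real (\<Delta> (V0_part \<alpha> x)) powr e * f x) = f x"
proof (cases "x \<in> makarevich_space \<alpha>")
  case True
  then show ?thesis
    using jordan_det_makarevich_pos[OF \<alpha> \<Delta> True]
    by (simp add: of_real_powr_pos exp_minus)
next
  case False
  then show ?thesis
    using f by (auto simp: Cc_def)
qed

lemma M_op_inj:
  assumes "f \<in> Cc (makarevich_space \<alpha>)" "g \<in> Cc (makarevich_space \<alpha>)"
    and "M_op \<Delta> \<alpha> s f = M_op \<Delta> \<alpha> s g"
  shows "f = g"
proof
  fix x
  have "M_op \<Delta> \<alpha> s f x = M_op \<Delta> \<alpha> s g x"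
    using assms(3) by simp
  then show "f x = g x"
    using det_V0_part_powr_cancel[OF assms(1), of x] det_V0_part_powr_cancel[OF assms(2), of x]
    unfolding M_op_def by metis
qed

text \<open>The preimage is obtained by multiplying with the opposite power of the determinant,
  which is continuous on the space because the determinant is positive there.\<close>

lemma M_op_surj:
  assumes "F \<in> Cc (makarevich_space \<alpha>)"
  obtains f where "f \<in> Cc (makarevich_space \<alpha>)" "F = M_op \<Delta> \<alpha> s f"
proof
  let ?e = "s + of_real (dim_over_rank TYPE('a) / 2)"
  let ?f = "\<lambda>x. complex_of_real (\<Delta> (V0_part \<alpha> x)) powr (- ?e) * F x"
  show "?f \<in> Cc (makarevich_space \<alpha>)"
    by (rule det_V0_part_powr_mult_Cc[OF assms])
  show "F = M_op \<Delta> \<alpha> s ?f"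
  proof
    fix x
    show "F x = M_op \<Delta> \<alpha> s ?f x"
      using det_V0_part_powr_cancel[OF assms, of x ?e] unfolding M_op_def
      by (simp only: mult.left_commute)
  qed
qed

text \<open>Injectivity of \<open>M_op\<close> leaves a single candidate value in the
  \<open>THE\<close> of \<open>form_B_alpha\<close>.\<close>

lemma form_B_alpha_M_op:
  assumes "f1 \<in> Cc (makarevich_space \<alpha>)" "f2 \<in> Cc (makarevich_space \<alpha>)"
  shows "form_B_alpha \<Delta> \<alpha> s (M_op \<Delta> \<alpha> s f1) (M_op \<Delta> \<alpha> s f2) = form_B_tilde \<Delta> \<alpha> s f1 f2"
  unfolding form_B_alpha_def using assms M_op_inj by (intro the_equality) blast+

text \<open>The substitution \<open>T\<close> on pairs is itself a linear involution of the product
  space, so invariance of Lebesgue measure applies to it directly.\<close>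

lemma form_B_tilde_eq:
  assumes "f1 \<in> Cc (makarevich_space \<alpha>)" "f2 \<in> Cc (makarevich_space \<alpha>)"
  shows "form_B_tilde \<Delta> \<alpha> s f1 f2 = (LINT (x, y)|(lborel \<Otimes>\<^sub>M lborel).
     complex_of_real \<bar>\<Delta> (x + \<alpha> y)\<bar> powr (2 * s - of_real (dim_over_rank TYPE('a))) * f1 x * f2 y)"
proof -
  define T where "T = (\<lambda>p :: 'a \<times> 'a. (fst p, - \<alpha> (snd p)))"
  define H where "H = (\<lambda>(x, y). complex_of_real \<bar>\<Delta> (x - y)\<bar> powr
    (2 * s - of_real (dim_over_rank TYPE('a))) * f1 x * f2 (- \<alpha> y))"
  note lin = euclidean_involution_linear[OF \<alpha>] and inv = euclidean_involution_involutive[OF \<alpha>]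
  have [measurable]: "f1 \<in> borel_measurable borel" "f2 \<in> borel_measurable borel"
    using assms open_makarevich_space[OF \<alpha>] by (auto intro: borel_measurable_Cc)
  have [measurable]: "\<alpha> \<in> borel_measurable borel" "\<Delta> \<in> borel_measurable borel"
    using lin by (auto intro!: borel_measurable_continuous_onI is_jordan_det_continuous[OF \<Delta>]
        simp: linear_continuous_on linear_conv_bounded_linear)
  have [measurable]: "H \<in> borel_measurable (borel \<Otimes>\<^sub>M borel)"
    unfolding H_def by measurable
  then have H: "H \<in> borel_measurable borel"
    by (simp add: borel_prod)
  have linT: "linear T"
    unfolding T_def
    by (rule linearI) (simp_all add: linear_add[OF lin] linear_scale[OF lin])
  have T: "distr lborel borel T = lborel"
    by (rule lborel_distr_linear_involution[OF linT])
      (simp add: T_def linear_neg[OF lin] inv)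
  have "form_B_tilde \<Delta> \<alpha> s f1 f2 = integral\<^sup>L lborel H"
    by (simp add: form_B_tilde_def form_B_def H_def lborel_prod)
  also have "\<dots> = integral\<^sup>L (distr lborel borel T) H"
    by (simp only: T)
  also have "\<dots> = (LINT p|lborel. H (T p))"
    using H linT by (intro integral_distr)
      (auto intro!: borel_measurable_continuous_onI
        simp: linear_continuous_on linear_conv_bounded_linear)
  finally show ?thesis
    by (simp add: H_def T_def lborel_prod linear_neg[OF lin] inv case_prod_unfold)
qed

lemma integral_mu_pair:
  fixes K :: "'a \<times> 'a \<Rightarrow> complex"
  assumes K: "K \<in> borel_measurable (borel \<Otimes>\<^sub>M borel)"
  defines "w \<equiv> \<lambda>x. indicator (makarevich_space \<alpha>) x *
     \<Delta> (V0_part \<alpha> x) powr (- dim_over_rank TYPE('a))"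
  shows "integral\<^sup>L (mu \<Delta> \<alpha> \<Otimes>\<^sub>M mu \<Delta> \<alpha>) K =
    (LINT (x, y)|(lborel \<Otimes>\<^sub>M lborel). (w x * w y) *\<^sub>R K (x, y))"
proof -
  have "makarevich_space \<alpha> \<in> sets borel"
    using open_makarevich_space[OF \<alpha>] by simp
  moreover have "(\<lambda>x. \<Delta> (V0_part \<alpha> x)) \<in> borel_measurable borel"
    by (rule borel_measurable_continuous_onI[OF continuous_on_det_V0_part])
  ultimately have [measurable]: "w \<in> borel_measurable borel"
    unfolding w_def by measurable
  have nonneg: "0 \<le> w x" for x
    by (simp add: w_def)
  have mu: "mu \<Delta> \<alpha> = density lborel (\<lambda>x. ennreal (w x))"
    by (simp add: mu_def w_def)
  have "sigma_finite_measure (density lborel (\<lambda>x. ennreal (w x)))"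
    by (subst sigma_finite_measure.sigma_finite_iff_density_finite[OF sigma_finite_lborel]) auto
  then have "mu \<Delta> \<alpha> \<Otimes>\<^sub>M mu \<Delta> \<alpha> = density (lborel \<Otimes>\<^sub>M lborel) (\<lambda>(x, y). ennreal (w x) * ennreal (w y))"
    unfolding mu
    by (intro pair_measure_density sigma_finite_lborel) auto
  also have "\<dots> = density (lborel \<Otimes>\<^sub>M lborel) (\<lambda>p. ennreal (w (fst p) * w (snd p)))"
    by (simp add: case_prod_unfold ennreal_mult nonneg)
  finally have "integral\<^sup>L (mu \<Delta> \<alpha> \<Otimes>\<^sub>M mu \<Delta> \<alpha>) K =
      (LINT p|(lborel \<Otimes>\<^sub>M lborel). (w (fst p) * w (snd p)) *\<^sub>R K p)"
    using K by (simp add: integral_density nonneg)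
  then show ?thesis
    by (simp add: case_prod_unfold)
qed

text \<open>With \<open>a\<close>, \<open>b\<close> the determinants of the \<open>V0\<close>-parts
  and \<open>d\<close> that of \<open>x + \<alpha> y\<close>, the Berezin function is
  \<open>4 ^ r * a * b / d\<^sup>2\<close>. The exponents of \<open>a\<close> and of
  \<open>b\<close> then sum to 0, those of 2 cancel because \<open>n = \<kappa> * r\<close>, and
  \<open>\<bar>d\<bar>\<close> is left with \<open>2 * s - \<kappa>\<close>.\<close>

lemma kernel_identity:
  assumes x: "x \<in> makarevich_space \<alpha>" and y: "y \<in> makarevich_space \<alpha>"
  defines "r \<equiv> jordan_rank (UNIV :: 'a set)" and "\<kappa> \<equiv> dim_over_rank TYPE('a)"
  shows "2 powr (2 * of_nat r * s - of_nat DIM('a)) *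
      complex_of_real (\<Delta> (V0_part \<alpha> x) powr (- \<kappa>) * \<Delta> (V0_part \<alpha> y) powr (- \<kappa>)) *
      complex_of_real (berezin_F \<Delta> \<alpha> x y) powr (- (s - of_real \<kappa> / 2)) *
      complex_of_real (\<Delta> (V0_part \<alpha> x)) powr (s + of_real (\<kappa> / 2)) *
      complex_of_real (\<Delta> (V0_part \<alpha> y)) powr (s + of_real (\<kappa> / 2)) =
    complex_of_real \<bar>\<Delta> (x + \<alpha> y)\<bar> powr (2 * s - of_real \<kappa>)"
proof -
  note lin = euclidean_involution_linear[OF \<alpha>] and inv = euclidean_involution_involutive[OF \<alpha>]
  define a b d where "a = \<Delta> (V0_part \<alpha> x)" and "b = \<Delta> (V0_part \<alpha> y)" and "d = \<Delta> (x + \<alpha> y)"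
  have ab: "a > 0" "b > 0"
    using jordan_det_makarevich_pos[OF \<alpha> \<Delta>] x y by (auto simp: a_def b_def)
  have double: "\<Delta> (z + \<alpha> z) = 2 ^ r * \<Delta> (V0_part \<alpha> z)" for z
  proof -
    have "z + \<alpha> z = 2 *\<^sub>R V0_part \<alpha> z"
      by (simp add: V0_part_def)
    then show ?thesis
      using jordan_det_scaleR[OF \<Delta>, of 2 "V0_part \<alpha> z"] by (simp add: r_def)
  qed
  have "\<Delta> (y + \<alpha> x) = d"
    using jordan_det_involution[OF \<alpha> \<Delta>, of "x + \<alpha> y"]
    by (simp add: d_def linear_add[OF lin] inv add.commute)
  then have F: "berezin_F \<Delta> \<alpha> x y = (2 ^ r * a * (2 ^ r * b)) / d\<^sup>2"
    by (simp add: berezin_F_def double a_def b_def d_def[symmetric] power2_eq_square)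
  show ?thesis
  proof (cases "d = 0")
    \<comment> \<open>Both sides are 0: division by zero makes \<open>berezin_F\<close> equal to 0,
      and \<open>powr\<close> with base 0 is 0.\<close>
    case True
    then show ?thesis
      by (simp add: F d_def[symmetric])
  next
    case False
    have "r > 0"
      unfolding r_def by (rule jordan_rank_pos[of 1]) simp
    then have n: "real DIM('a) = \<kappa> * real r"
      by (simp add: \<kappa>_def dim_over_rank_def r_def)
    have Fpos: "berezin_F \<Delta> \<alpha> x y > 0"
      using ab False by (simp add: F)
    have lnF: "ln (berezin_F \<Delta> \<alpha> x y) = 2 * real r * ln 2 + ln a + ln b - 2 * ln \<bar>d\<bar>"
    proof -
      have "ln (d\<^sup>2) = 2 * ln \<bar>d\<bar>"
        using False ln_realpow[of "\<bar>d\<bar>" 2] by simp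
      then show ?thesis
        using ab False by (simp add: F ln_div ln_mult ln_realpow)
    qed
    have powr_exp: "complex_of_real (t powr (- \<kappa>)) = exp (of_real (- \<kappa> * ln t))" if "t > 0" for t
      using that by (simp add: powr_def exp_of_real[symmetric])
    have nc: "of_nat DIM('a) = complex_of_real \<kappa> * of_nat r"
      using arg_cong[OF n, of complex_of_real] by simp
    have two: "2 powr (2 * of_nat r * s - complex_of_real \<kappa> * of_nat r) =
        exp ((2 * of_nat r * s - complex_of_real \<kappa> * of_nat r) * complex_of_real (ln 2))"
      using of_real_powr_pos[of 2] by simp
    have dpos: "0 < \<bar>d\<bar>"
      using False by simp
    show ?thesis
      unfolding a_def[symmetric] b_def[symmetric] d_def[symmetric] nc two of_real_mult
        powr_exp[OF ab(1)] powr_exp[OF ab(2)] of_real_powr_pos[OF ab(1)] of_real_powr_pos[OF ab(2)]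
        of_real_powr_pos[OF Fpos] of_real_powr_pos[OF dpos] lnF mult_exp_exp
      by (rule arg_cong[of _ _ exp]) (simp add: algebra_simps)
  qed
qed

lemma form_B_tilde_eq_berezin:
  assumes f1: "f1 \<in> Cc (makarevich_space \<alpha>)" and f2: "f2 \<in> Cc (makarevich_space \<alpha>)"
  defines "r \<equiv> jordan_rank (UNIV :: 'a set)" and "r0 \<equiv> jordan_rank (V0 \<alpha>)"
  assumes \<nu>: "\<nu> = - (of_nat r / of_nat r0) * (s - of_nat DIM('a) / (2 * of_nat r))"
  shows "form_B_tilde \<Delta> \<alpha> s f1 f2 = 2 powr (2 * of_nat r * s - of_nat DIM('a)) *
    (LINT (x, y)|(mu \<Delta> \<alpha> \<Otimes>\<^sub>M mu \<Delta> \<alpha>).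
      berezin_kernel \<Delta> \<alpha> \<nu> x y * M_op \<Delta> \<alpha> s f1 x * M_op \<Delta> \<alpha> s f2 y)"
proof -
  note lin = euclidean_involution_linear[OF \<alpha>]
  let ?\<kappa> = "dim_over_rank TYPE('a)"
  have "r > 0" "r0 > 0"
    unfolding r_def r0_def by (auto intro: jordan_rank_pos V0_one[OF \<alpha>])
  \<comment> \<open>The choice of \<open>\<nu>\<close> removes \<open>r0\<close> from the exponent
    of the Berezin kernel.\<close>
  have exponent: "of_nat r0 / of_nat r * \<nu> = - (s - of_real ?\<kappa> / 2)"
    using \<open>r > 0\<close> \<open>r0 > 0\<close> by (simp add: \<nu> dim_over_rank_def r_def[symmetric] field_simps)
  have kernel: "berezin_kernel \<Delta> \<alpha> \<nu> x y =
      complex_of_real (berezin_F \<Delta> \<alpha> x y) powr (- (s - of_real ?\<kappa> / 2))" for x y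
    unfolding berezin_kernel_def r_def[symmetric] r0_def[symmetric] exponent ..
  have [measurable]: "f1 \<in> borel_measurable borel" "f2 \<in> borel_measurable borel"
    using f1 f2 open_makarevich_space[OF \<alpha>] by (auto intro: borel_measurable_Cc)
  have [measurable]: "\<alpha> \<in> borel_measurable borel" "\<Delta> \<in> borel_measurable borel"
    using lin by (auto intro!: borel_measurable_continuous_onI is_jordan_det_continuous[OF \<Delta>]
        simp: linear_continuous_on linear_conv_bounded_linear)
  have [measurable]: "(\<lambda>x. \<Delta> (V0_part \<alpha> x)) \<in> borel_measurable borel"
    by (rule borel_measurable_continuous_onI[OF continuous_on_det_V0_part])
  define w where "w = (\<lambda>x. indicator (makarevich_space \<alpha>) x * \<Delta> (V0_part \<alpha> x) powr (- ?\<kappa>))"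
  define K where "K = (\<lambda>(x, y). berezin_kernel \<Delta> \<alpha> \<nu> x y * M_op \<Delta> \<alpha> s f1 x * M_op \<Delta> \<alpha> s f2 y)"
  have "K \<in> borel_measurable (borel \<Otimes>\<^sub>M borel)"
    unfolding K_def kernel M_op_def berezin_F_def by measurable
  then have "2 powr (2 * of_nat r * s - of_nat DIM('a)) * integral\<^sup>L (mu \<Delta> \<alpha> \<Otimes>\<^sub>M mu \<Delta> \<alpha>) K =
      2 powr (2 * of_nat r * s - of_nat DIM('a)) *
      (LINT (x, y)|(lborel \<Otimes>\<^sub>M lborel). (w x * w y) *\<^sub>R K (x, y))"
    by (simp add: integral_mu_pair w_def)
  also have "\<dots> = (LINT (x, y)|(lborel \<Otimes>\<^sub>M lborel).
      2 powr (2 * of_nat r * s - of_nat DIM('a)) * ((w x * w y) *\<^sub>R K (x, y)))"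
    by (subst integral_mult_right_zero[symmetric]) (simp add: case_prod_unfold)
  also have "\<dots> = (LINT (x, y)|(lborel \<Otimes>\<^sub>M lborel).
      complex_of_real \<bar>\<Delta> (x + \<alpha> y)\<bar> powr (2 * s - of_real ?\<kappa>) * f1 x * f2 y)"
  proof -
    \<comment> \<open>The integrands agree pointwise, so the equality holds for every
      \<open>s\<close>; if they are not integrable, both integrals take the default value 0.\<close>
    have "2 powr (2 * of_nat r * s - of_nat DIM('a)) * ((w x * w y) *\<^sub>R K (x, y)) =
        complex_of_real \<bar>\<Delta> (x + \<alpha> y)\<bar> powr (2 * s - of_real ?\<kappa>) * f1 x * f2 y" for x y
    proof (cases "x \<in> makarevich_space \<alpha> \<and> y \<in> makarevich_space \<alpha>")
      case True
      then show ?thesis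
        unfolding kernel_identity[OF conjunct1[OF True] conjunct2[OF True], symmetric]
        by (simp add: w_def K_def kernel M_op_def r_def scaleR_conv_of_real mult_ac)
    next
      case False
      then have "f1 x = 0 \<or> f2 y = 0"
        using f1 f2 by (auto simp: Cc_def)
      then show ?thesis
        by (auto simp: K_def M_op_def)
    qed
    then show ?thesis
      by simp
  qed
  finally show ?thesis
    using form_B_tilde_eq[OF f1 f2] by (simp add: K_def)
qed

end

text \<open>The first conjunct confirms that \<open>form_B_alpha\<close> satisfies its defining
  relation. In the second, the power of 2 appears because \<open>berezin_F\<close> is normalised by
  \<open>\<Delta> (x + \<alpha> x)\<close>, while \<open>M_op\<close> and \<open>mu\<close> use the
  determinant of the \<open>V0\<close>-part.\<close>

theorem proposition2p7:
  fixes \<alpha> :: "'a::{euclidean_space, simple_real_jordan_algebra} \<Rightarrow> 'a"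
    and \<Delta> tr :: "'a \<Rightarrow> real"
    and s \<nu> :: complex
    and n r r0 :: nat
  assumes "euclidean_involution \<alpha>"
    and "is_jordan_det \<Delta>"
    and "is_jordan_trace tr"
    and "\<And>x y. x \<bullet> y = tr (x * \<alpha> y)"
    and "n = DIM('a)"
    and "r = jordan_rank (UNIV :: 'a set)"
    and "r0 = jordan_rank (V0 \<alpha>)"
    and "\<nu> = - (of_nat r / of_nat r0) * (s - of_nat n / (2 * of_nat r))"
  shows "(\<forall>f1\<in>Cc (makarevich_space \<alpha>). \<forall>f2\<in>Cc (makarevich_space \<alpha>).
           form_B_alpha \<Delta> \<alpha> s (M_op \<Delta> \<alpha> s f1) (M_op \<Delta> \<alpha> s f2) = form_B_tilde \<Delta> \<alpha> s f1 f2) \<and>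
         (\<forall>F1\<in>Cc (makarevich_space \<alpha>). \<forall>F2\<in>Cc (makarevich_space \<alpha>).
           form_B_alpha \<Delta> \<alpha> s F1 F2 = 2 powr (2 * of_nat r * s - of_nat n) *
             (LINT (x, y)|(mu \<Delta> \<alpha> \<Otimes>\<^sub>M mu \<Delta> \<alpha>). berezin_kernel \<Delta> \<alpha> \<nu> x y * F1 x * F2 y))"
proof (intro conjI ballI)
  show "form_B_alpha \<Delta> \<alpha> s (M_op \<Delta> \<alpha> s f1) (M_op \<Delta> \<alpha> s f2) = form_B_tilde \<Delta> \<alpha> s f1 f2"
    if "f1 \<in> Cc (makarevich_space \<alpha>)" "f2 \<in> Cc (makarevich_space \<alpha>)" for f1 f2
    using form_B_alpha_M_op[OF assms(1,2) that] .
  fix F1 F2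
  assume F: "F1 \<in> Cc (makarevich_space \<alpha>)" "F2 \<in> Cc (makarevich_space \<alpha>)"
  obtain f1 where f1: "f1 \<in> Cc (makarevich_space \<alpha>)" "F1 = M_op \<Delta> \<alpha> s f1"
    by (rule M_op_surj[OF assms(1,2) F(1)])
  obtain f2 where f2: "f2 \<in> Cc (makarevich_space \<alpha>)" "F2 = M_op \<Delta> \<alpha> s f2"
    by (rule M_op_surj[OF assms(1,2) F(2)])
  show "form_B_alpha \<Delta> \<alpha> s F1 F2 = 2 powr (2 * of_nat r * s - of_nat n) *
      (LINT (x, y)|(mu \<Delta> \<alpha> \<Otimes>\<^sub>M mu \<Delta> \<alpha>). berezin_kernel \<Delta> \<alpha> \<nu> x y * F1 x * F2 y)"
    unfolding f1(2) f2(2) form_B_alpha_M_op[OF assms(1,2) f1(1) f2(1)]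
    using form_B_tilde_eq_berezin[OF assms(1,2) f1(1) f2(1), of \<nu> s] assms(5-8) by simp
qed

end
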